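(* For every integer $n\geq 0$ let $b_n:\mathbb{C}^{n+1}\to\mathbb{C}$ be a continuous function such that for every $a_0,a_1,\dots,a_{n-1}\in\mathbb{C}$ the function $\mathbb{C}\ni z\mapsto b_n(a_0,a_1,\dots,a_{n-1},z)$ is onto $\mathbb{C}$. Let $\mu$ be an infinite subset of $\mathbb{N}$. Then the set $U^\mu$ (defined in the context from the functions $b_n$ and the set $\mu$) is a $G_\delta$ and dense subset of the space $\mathbb{C}^{\aleph_0}$.
   Context: $\mathbb{N}=\{0,1,2,\dots\}$. $\mathbb{C}^{\aleph_0}$ is the space of all sequences $a=(a_0,a_1,\dots)$ of complex numbers, endowed with the product topology. For $a\in\mathbb{C}^{\aleph_0}$, an integer $N\geq 0$ and $z\in\mathbb{C}$, set $T_N(a)(z)=\sum_{n=0}^{N}b_n(a_0,\dots,a_n)z^n$. For $n=0$ the assumption on $b_n$ means that $b_0:\mathbb{C}\to\mathbb{C}$ is continuous and onto. The set $U^\mu$ is the set of all $a\in\mathbb{C}^{\aleph_0}$ such that for every compact set $K\subset\mathbb{C}\setminus\{0\}$ with connected complement and for every function $h:K\to\mathbb{C}$ which is continuous on $K$ and holomorphic in the interior of $K$, there exists a strictly increasing sequence of integers $(\lambda_m)_{m\in\mathbb{N}}$, $\lambda_m\in\mu$, such that $(T_{\lambda_m}(a)(z))_{m\in\mathbb{N}}$ converges to $h(z)$ uniformly on $K$ as $m\to+\infty$. *)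

theory Defs
  imports "HOL-Complex_Analysis.Complex_Analysis"
begin

(* The coordinates are indexed by I: {..n} gives C^(n+1), UNIV gives the space of all sequences.
   Points of the former are functions that are "undefined" outside {..n}. *)
abbreviation complex_product :: "nat set \<Rightarrow> (nat \<Rightarrow> complex) topology" where
  "complex_product I \<equiv> product_topology (\<lambda>_. euclidean) I"

definition T :: "(nat \<Rightarrow> (nat \<Rightarrow> complex) \<Rightarrow> complex) \<Rightarrow> nat \<Rightarrow> (nat \<Rightarrow> complex) \<Rightarrow> complex \<Rightarrow> complex" where
  "T b N a z = (\<Sum>n=0..N. b n (restrict a {..n}) * z ^ n)"

definition U :: "(nat \<Rightarrow> (nat \<Rightarrow> complex) \<Rightarrow> complex) \<Rightarrow> nat set \<Rightarrow> (nat \<Rightarrow> complex) set" where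
  "U b \<mu> = {a. \<forall>K h. compact K \<and> K \<subseteq> UNIV - {0} \<and> connected (UNIV - K) \<and>
      continuous_on K h \<and> h holomorphic_on interior K \<longrightarrow>
      (\<exists>l :: nat \<Rightarrow> nat. strict_mono l \<and> (\<forall>m. l m \<in> \<mu>) \<and>
        uniform_limit K (\<lambda>m. T b (l m) a) h sequentially)}"

end

theory Submission
  imports Defs
begin

text \<open>
  The set \<^term>\<open>U b \<mu>\<close> is exhibited as a countable intersection of dense open sets, and Baire's theorem in the
  completely metrizable space of sequences does the rest (\<open>theorem6\<close>).

  The members of the intersection are indexed by a compact set \<open>L\<close> from a countable family, a polynomial \<open>p\<close>
  from a countable uniformly dense family, a precision \<open>1/(k+1)\<close> and a bound \<open>M\<close>; such a member consists of
  those \<open>a\<close> for which some \<open>T b l a\<close> with \<open>l \<in> \<mu>\<close>, \<open>l \<ge> M\<close>, is within the precision of \<open>p\<close> on \<open>L\<close>.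
  Three facts are needed.
  \<^item> The intersection is all of \<^term>\<open>U b \<mu>\<close> (\<open>U_iff_polynomials\<close>). The compact sets without 0 and with connected
    complement have a countable cofinal subfamily (\<open>countable_exhaustion_connected_complement\<close>), so that \<open>K\<close> may be
    enlarged to some \<open>L\<close>; and a function continuous on \<open>K\<close> and holomorphic inside may be replaced by a polynomial.
    The latter is exactly Mergelyan's theorem.
  \<^item> The members are open, because \<open>T b l a\<close> depends on \<open>a\<close> through finitely many continuous coefficients.
  \<^item> The members are dense (\<open>T_approximates_densely\<close>). A basic open set restricts only \<open>a 0, \<dots>, a N\<close>. As 0 is not in \<open>L\<close>,
    \<open>(p - T b N a) / z ^ (N+1)\<close> is uniformly approximable on \<open>L\<close> by a polynomial \<open>q\<close>, and surjectivity of the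
    \<open>b n\<close> in the last variable allows the remaining coordinates to be chosen so that the later coefficients are
    those of \<open>z ^ (N+1) * q\<close>.

  Most of the text is a proof of Mergelyan's theorem that uses only contour integrals along the edges of squares.
  Extend the function to a continuous \<open>f\<close> with compact support and take a grid of squares of side \<open>d\<close>, so small
  that \<open>f\<close> oscillates by at most \<open>\<omega>\<close> on neighbouring squares. For \<open>z\<close> in \<open>K\<close>, the integrals of \<open>f x / (x - z)\<close>
  over the boundaries of all squares add up to 0, and those over the 3 by 3 block around \<open>z\<close> add up to
  \<open>2 \<pi> \<i> f z + O(\<omega>)\<close>. Hence \<open>2 \<pi> \<i> f z\<close> is, up to \<open>O(\<omega>)\<close>, minus the sum of the integrals over the other squares.
  Those over squares inside \<open>K\<close> vanish by Cauchy's theorem. Any other square has a point \<open>p\<close> outside \<open>K\<close> nearby.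
  Since the complement of \<open>K\<close> is connected, one can walk in it from \<open>p\<close> to a point \<open>q\<close> at distance about \<open>d\<close>, and this
  makes \<open>sqrt ((z - p) * (z - q))\<close> available as a uniform limit of polynomials on \<open>K\<close> (\<open>poly_approx_sqrt\<close>).
  From this square root one builds functions that are bounded by multiples of \<open>1/d\<close> and \<open>1/d^2\<close> on \<open>K\<close>
  and differ from \<open>1 / (z - \<zeta>)\<close> and \<open>1 / (z - \<zeta>)^2\<close> only by terms of third order in \<open>1 / (z - \<zeta>)\<close>
  far away (\<open>kernels_at_point\<close>).
  Replacing the first two terms of the Laurent expansion of the integral by these functions gives \<open>F\<close>, a limit of
  polynomials, with an error of \<open>O(\<omega> / k^3)\<close> for a square \<open>k\<close> steps away from \<open>z\<close> (\<open>square_approx\<close>). There are \<open>O(k)\<close>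
  such squares, so all errors together are \<open>O(\<omega>)\<close> with a constant that does not depend on the grid
  (\<open>Mergelyan_estimate\<close>). The third order is what makes this sum converge.
\<close>

section \<open>Uniform approximation by polynomials\<close>

definition poly_approx :: "complex set \<Rightarrow> (complex \<Rightarrow> complex) \<Rightarrow> bool" where
  "poly_approx K g \<longleftrightarrow> (\<forall>e>0. \<exists>p. \<forall>z\<in>K. norm (g z - poly p z) < e)"

lemma poly_approx_limit:
  assumes "\<And>e. e > 0 \<Longrightarrow> \<exists>h. poly_approx K h \<and> (\<forall>z\<in>K. norm (g z - h z) < e)"
  shows "poly_approx K g"
  unfolding poly_approx_def
proof (intro allI impI)
  fix e :: real assume "e > 0"
  then obtain h where h: "poly_approx K h" "\<forall>z\<in>K. norm (g z - h z) < e/2"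
    using assms[of "e/2"] by auto
  then obtain p where p: "\<forall>z\<in>K. norm (h z - poly p z) < e/2"
    using \<open>e > 0\<close> unfolding poly_approx_def by (meson half_gt_zero)
  have "norm (g z - poly p z) < e" if "z \<in> K" for z
    using h(2) p that norm_triangle_lt[of "g z - h z" "h z - poly p z" e] by fastforce
  then show "\<exists>p. \<forall>z\<in>K. norm (g z - poly p z) < e" by blast
qed

lemma poly_approx_poly: "poly_approx K (poly p)"
  unfolding poly_approx_def by (metis diff_self norm_zero)

lemma poly_approx_cong:
  assumes "poly_approx K f" "\<And>z. z \<in> K \<Longrightarrow> f z = g z"
  shows "poly_approx K g"
  using assms unfolding poly_approx_def by simp

lemma poly_approx_const: "poly_approx K (\<lambda>z. c)"
  by (rule poly_approx_cong[OF poly_approx_poly[of K "[:c:]"]]) simp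

lemma poly_approx_ident: "poly_approx K (\<lambda>z. z)"
  by (rule poly_approx_cong[OF poly_approx_poly[of K "[:0, 1:]"]]) simp

lemma poly_approx_add:
  assumes "poly_approx K f" "poly_approx K g"
  shows "poly_approx K (\<lambda>z. f z + g z)"
  unfolding poly_approx_def
proof (intro allI impI)
  fix e :: real assume "e > 0"
  then obtain p q where p: "\<forall>z\<in>K. norm (f z - poly p z) < e/2"
      and q: "\<forall>z\<in>K. norm (g z - poly q z) < e/2"
    using assms unfolding poly_approx_def by (meson half_gt_zero)
  have "norm (f z + g z - poly (p + q) z) < e" if "z \<in> K" for z
    using norm_triangle_lt[of "f z - poly p z" "g z - poly q z" e] p q that
    by (fastforce simp: algebra_simps)
  then show "\<exists>p. \<forall>z\<in>K. norm (f z + g z - poly p z) < e" by blast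
qed

lemma poly_approx_bounded:
  assumes "poly_approx K f" "compact K"
  obtains B where "B > 0" "\<And>z. z \<in> K \<Longrightarrow> norm (f z) \<le> B"
proof -
  obtain p where p: "\<forall>z\<in>K. norm (f z - poly p z) < 1"
    using assms unfolding poly_approx_def by (meson zero_less_one)
  have "bounded (poly p ` K)"
    by (intro compact_imp_bounded compact_continuous_image continuous_intros assms(2))
  then obtain C where C: "C > 0" "\<forall>w \<in> poly p ` K. norm w \<le> C"
    unfolding bounded_pos by blast
  have "norm (f z) \<le> C + 1" if "z \<in> K" for z
    using p C that norm_triangle_sub[of "f z" "poly p z"] by fastforce
  then show thesis using that[of "C+1"] C by simp
qed

lemma poly_approx_mult:
  assumes "compact K" "poly_approx K f" "poly_approx K g"
  shows "poly_approx K (\<lambda>z. f z * g z)"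
  unfolding poly_approx_def
proof (intro allI impI)
  fix e :: real assume "e > 0"
  obtain B where B: "B > 0" "\<And>z. z \<in> K \<Longrightarrow> norm (f z) \<le> B"
    using poly_approx_bounded assms by blast
  obtain q where q: "\<forall>z\<in>K. norm (g z - poly q z) < e/(2*B)"
    using assms(3) \<open>e > 0\<close> B unfolding poly_approx_def by (meson divide_pos_pos mult_pos_pos zero_less_numeral)
  obtain C where C: "C > 0" "\<And>z. z \<in> K \<Longrightarrow> norm (poly q z) \<le> C"
    using poly_approx_bounded[OF poly_approx_poly] assms by blast
  obtain p where p: "\<forall>z\<in>K. norm (f z - poly p z) < e/(2*C)"
    using assms(2) \<open>e > 0\<close> C unfolding poly_approx_def by (meson divide_pos_pos mult_pos_pos zero_less_numeral)
  have "norm (f z * g z - poly (p * q) z) < e" if "z \<in> K" for z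
  proof -
    have "f z * g z - poly (p * q) z = f z * (g z - poly q z) + (f z - poly p z) * poly q z"
      by (simp add: algebra_simps)
    also have "norm \<dots> \<le> norm (f z) * norm (g z - poly q z) + norm (f z - poly p z) * norm (poly q z)"
      by (metis norm_mult norm_triangle_ineq)
    also have "\<dots> \<le> B * norm (g z - poly q z) + norm (f z - poly p z) * C"
      using B C that by (intro add_mono mult_mono) auto
    also have "\<dots> < B * (e/(2*B)) + (e/(2*C)) * C"
      using B C that p q by (intro add_strict_mono mult_strict_left_mono mult_strict_right_mono) auto
    also have "\<dots> = e" using B C by simp
    finally show ?thesis .
  qed
  then show "\<exists>p. \<forall>z\<in>K. norm (f z * g z - poly p z) < e" by blast
qed

lemma poly_approx_cmult:
  "compact K \<Longrightarrow> poly_approx K f \<Longrightarrow> poly_approx K (\<lambda>z. c * f z)"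
  by (intro poly_approx_mult poly_approx_const)

lemma poly_approx_diff:
  assumes "compact K" "poly_approx K f" "poly_approx K g"
  shows "poly_approx K (\<lambda>z. f z - g z)"
  using poly_approx_add[OF assms(2) poly_approx_cmult[OF assms(1,3), of "-1"]] by simp

lemma poly_approx_power:
  "compact K \<Longrightarrow> poly_approx K f \<Longrightarrow> poly_approx K (\<lambda>z. f z ^ n)"
  by (induction n) (auto intro: poly_approx_const poly_approx_mult)

lemma poly_approx_sum:
  "(\<And>i. i \<in> I \<Longrightarrow> poly_approx K (f i)) \<Longrightarrow> poly_approx K (\<lambda>z. \<Sum>i\<in>I. f i z)"
  by (induction I rule: infinite_finite_induct) (auto intro: poly_approx_const poly_approx_add)

text \<open>
  The Taylor polynomials of \<open>\<phi>\<close> at 0 converge uniformly on the closed disc of radius \<open>1/2\<close>. The cases of interest are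
  \<open>1 / (1 - u)\<close>, which moves poles, and \<open>sqrt (1 - u)\<close>, which moves branch points.
\<close>
lemma poly_approx_compose:
  assumes "compact K" "poly_approx K u" "\<And>z. z \<in> K \<Longrightarrow> norm (u z) \<le> 1/2"
    and phi: "\<phi> holomorphic_on ball 0 1"
  shows "poly_approx K (\<lambda>z. \<phi> (u z))"
proof (rule poly_approx_limit)
  fix e :: real assume "e > 0"
  define a where "a n = (deriv ^^ n) \<phi> 0 / fact n" for n
  have sums: "(\<lambda>n. a n * w ^ n) sums \<phi> w" if "norm w < 1" for w
    using holomorphic_power_series[OF phi, of w] that by (simp add: a_def)
  have "summable (\<lambda>n. a n * (3/4) ^ n)"
    using sums[of "3/4"] by (simp add: sums_iff)
  then have rad: "ereal (1/2) < conv_radius a"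
    using conv_radius_geI[of a "3/4"] by (simp add: ereal_less_le less_le_trans[of "ereal (1/2)" "ereal (3/4)"])
  have "uniform_limit (cball 0 (1/2)) (\<lambda>n x. \<Sum>i<n. a i * (x - 0) ^ i) (\<lambda>x. suminf (\<lambda>i. a i * (x - 0) ^ i)) sequentially"
    by (rule powser_uniform_limit[OF rad])
  then obtain n where n: "\<forall>x\<in>cball 0 (1/2). dist (\<Sum>i<n. a i * x ^ i) (\<Sum>i. a i * x ^ i) < e"
    using \<open>e > 0\<close> unfolding uniform_limit_iff eventually_sequentially by fastforce
  have "norm (\<phi> (u z) - (\<Sum>i<n. a i * u z ^ i)) < e" if "z \<in> K" for z
  proof -
    have "norm (u z) \<le> 1/2" using assms(3) that by auto
    moreover from this have "(\<Sum>i. a i * u z ^ i) = \<phi> (u z)" using sums[of "u z"] by (simp add: sums_iff)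
    ultimately show ?thesis using n[rule_format, of "u z"] by (simp add: dist_norm norm_minus_commute)
  qed
  moreover have "poly_approx K (\<lambda>z. \<Sum>i<n. a i * u z ^ i)"
    using assms by (intro poly_approx_sum poly_approx_cmult poly_approx_power) auto
  ultimately show "\<exists>h. poly_approx K h \<and> (\<forall>z\<in>K. norm (\<phi> (u z) - h z) < e)" by blast
qed

text \<open>
  Multiplying by \<open>1 / (1 - u)\<close> or \<open>sqrt (1 - u)\<close> with \<open>u = (y - x) / (z - x)\<close> carries a pole or a branch point from \<open>x\<close> to \<open>y\<close>;
  by \<open>poly_approx_compose\<close> this is harmless when \<open>u\<close> is at most \<open>1/2\<close> on \<open>K\<close>. Such steps lead from any point of a connected
  complement to any other, since near each point they are possible in both directions. The bound \<open>\<delta>\<close> on their length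
  keeps a walk from jumping over an annulus.
\<close>
lemma complement_induct:
  fixes K :: "complex set"
  assumes "compact K" "connected (- K)" "a \<notin> K" "P a" "b \<notin> K" "\<delta> > 0"
    and step: "\<And>x y. \<lbrakk>x \<notin> K; y \<notin> K; P x; \<And>z. z \<in> K \<Longrightarrow> dist x y \<le> dist x z / 2; dist x y \<le> \<delta>\<rbrakk> \<Longrightarrow> P y"
  shows "P b"
proof (rule connected_induction_simple[of "- K" a b P])
  fix c assume c: "c \<in> - K"
  have "open (- K)" using assms compact_imp_closed by blast
  then obtain r0 where r0: "r0 > 0" "ball c r0 \<subseteq> - K" using c openE by blast
  define r where "r = min (r0/6) (\<delta>/2)"
  have r: "r > 0" "r \<le> r0/6" "r \<le> \<delta>/2" using r0 \<open>\<delta> > 0\<close> by (auto simp: r_def)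
  have "P y" if "x \<in> ball c r" "y \<in> ball c r" "P x" for x y
  proof (rule step[of x])
    show "x \<notin> K" "y \<notin> K" using that r r0 by (auto simp: subset_iff)
    have xy: "dist x y \<le> 2 * r" using that by (metis dist_commute dist_triangle_less_add less_eq_real_def mem_ball mult_2)
    then show "dist x y \<le> \<delta>" using r by simp
    show "dist x y \<le> dist x z / 2" if "z \<in> K" for z
    proof -
      have "r0 \<le> dist c z" using r0 that by (meson ComplD linorder_not_less mem_ball subsetD)
      then show ?thesis using xy r dist_triangle[of c z x] \<open>x \<in> ball c r\<close> by simp
    qed
  qed fact
  moreover have "openin (top_of_set (- K)) (ball c r)"
    using r r0 by (intro open_subset order_trans[OF _ r0(2)] subset_ball) auto
  moreover have "c \<in> ball c r" using r by simp
  ultimately show "\<exists>T. openin (top_of_set (- K)) T \<and> c \<in> T \<and> (\<forall>x\<in>T. \<forall>y\<in>T. P x \<longrightarrow> P y)"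
    by blast
qed (use assms(2-5) in auto)

lemma geometric_holomorphic: "(\<lambda>u. 1 / (1 - u)) holomorphic_on ball (0::complex) 1"
  by (intro holomorphic_intros) auto

text \<open>
  Far out the reciprocal is a geometric series in \<open>z\<close>; from there the pole is pushed to \<open>b\<close>.
\<close>
lemma poly_approx_pole:
  assumes "compact K" "connected (- K)" "b \<notin> K"
  shows "poly_approx K (\<lambda>z. 1 / (z - b))"
proof -
  obtain R where R: "R > 0" "\<And>z. z \<in> K \<Longrightarrow> norm z \<le> R"
    using compact_imp_bounded[OF assms(1)] unfolding bounded_pos by blast
  define a where "a = complex_of_real (2 * R)"
  have na: "norm a = 2 * R" using R by (simp add: a_def)
  then have "a \<noteq> 0" "a \<notin> K" using R by (force)+
  show ?thesis
  proof (rule complement_induct[OF assms(1,2) \<open>a \<notin> K\<close> _ assms(3) zero_less_one])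
    have "poly_approx K (\<lambda>z. 1 / (1 - (1/a) * z))"
    proof (rule poly_approx_compose[OF assms(1) _ _ geometric_holomorphic])
      show "norm (1 / a * z) \<le> 1 / 2" if "z \<in> K" for z
        using R that na by (simp add: norm_divide divide_simps)
    qed (intro poly_approx_cmult poly_approx_ident assms)
    then have "poly_approx K (\<lambda>z. (- 1/a) * (1 / (1 - (1/a) * z)))"
      by (intro poly_approx_cmult assms)
    then show "poly_approx K (\<lambda>z. 1 / (z - a))"
    proof (rule poly_approx_cong)
      fix z assume "z \<in> K"
      then have "z \<noteq> a" using \<open>a \<notin> K\<close> by auto
      then show "(- 1/a) * (1 / (1 - (1/a) * z)) = 1 / (z - a)"
        using \<open>a \<noteq> 0\<close> by (simp add: field_simps)
    qed
  next
    fix x y assume *: "x \<notin> K" "y \<notin> K" "poly_approx K (\<lambda>z. 1 / (z - x))"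
      "\<And>z. z \<in> K \<Longrightarrow> dist x y \<le> dist x z / 2"
    let ?u = "\<lambda>z. (y - x) * (1 / (z - x))"
    have "poly_approx K (\<lambda>z. 1 / (1 - ?u z))"
    proof (rule poly_approx_compose[OF assms(1) _ _ geometric_holomorphic])
      show "norm (?u z) \<le> 1 / 2" if "z \<in> K" for z
        using *(4)[OF that] *(1) that
        by (auto simp: norm_mult norm_divide divide_simps dist_norm norm_minus_commute mult.commute)
    qed (intro poly_approx_cmult * assms)
    then have "poly_approx K (\<lambda>z. (1 / (z - x)) * (1 / (1 - ?u z)))"
      by (intro poly_approx_mult * assms)
    then show "poly_approx K (\<lambda>z. 1 / (z - y))"
    proof (rule poly_approx_cong)
      fix z assume "z \<in> K"
      then have "z \<noteq> x" "z \<noteq> y" using * by auto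
      then show "(1 / (z - x)) * (1 / (1 - ?u z)) = 1 / (z - y)"
        by (simp add: divide_simps)
    qed
  qed
qed

section \<open>Replacements for reciprocals with a pole near the compact set\<close>

text \<open>
  Of the two square roots of a number near 1, the one in the right half-plane is near 1.
\<close>
lemma norm_diff_1_le_power2:
  fixes v :: complex
  assumes "Re v \<ge> 0"
  shows "norm (v - 1) \<le> norm (v^2 - 1)"
proof -
  have "1 \<le> norm (v + 1)"
    using assms abs_Re_le_cmod[of "v + 1"] by simp
  then have "norm (v - 1) * 1 \<le> norm (v - 1) * norm (v + 1)"
    by (intro mult_left_mono) auto
  also have "\<dots> = norm (v^2 - 1)"
    by (simp add: norm_mult[symmetric] power2_eq_square algebra_simps)
  finally show ?thesis by simp
qed

lemma csqrt_holomorphic: "(\<lambda>u. csqrt (1 - u)) holomorphic_on ball 0 1"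
proof -
  have "1 - u \<notin> \<real>\<^sub>\<le>\<^sub>0" if "u \<in> ball 0 1" for u :: complex
    using that abs_Re_le_cmod[of u] by (auto simp: complex_nonpos_Reals_iff)
  then show ?thesis by (intro holomorphic_intros) auto
qed

text \<open>
  Walking from \<open>p\<close> by the steps of \<open>complement_induct\<close> and multiplying principal square roots along the way produces a
  function \<open>v\<close> with \<open>v z ^ 2 = (z - x) / (z - p)\<close> for the current point \<open>x\<close>. While the walk stays within \<open>2 * \<delta>\<close> of \<open>p\<close>,
  \<open>v\<close> keeps positive real part at distance \<open>8 * \<delta>\<close> from \<open>p\<close>, which determines the branch there. If no
  reachable point had distance between \<open>\<delta>\<close> and \<open>2 * \<delta>\<close> from \<open>p\<close>, then no walk could leave the disc of
  radius \<open>\<delta>\<close>, although walks reach all of the unbounded complement. The desired root is \<open>(z - p) * v z\<close>.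
\<close>
lemma poly_approx_sqrt:
  assumes "compact K" "connected (- K)" "p \<notin> K" "\<delta> > 0"
  obtains q s where "\<delta> \<le> dist p q" "dist p q \<le> 2 * \<delta>" "poly_approx K s"
    "\<And>z. z \<in> K \<Longrightarrow> s z ^ 2 = (z - p) * (z - q)"
    "\<And>z. z \<in> K \<Longrightarrow> 8 * \<delta> \<le> dist z p \<Longrightarrow> norm (s z - (z - p)) \<le> dist z p / 4"
proof -
  define R where "R q \<longleftrightarrow> (\<exists>v. poly_approx K v \<and> (\<forall>z\<in>K. v z ^ 2 * (z - p) = z - q) \<and>
      (\<forall>z\<in>K. 8 * \<delta> \<le> dist z p \<longrightarrow> Re (v z) > 0))" for q
  \<comment> \<open>Far from \<open>p\<close> the quotient \<open>(z - q) / (z - p)\<close> is within \<open>1/4\<close> of 1, hence so is its root with positive real part.\<close>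
  have near_1: "norm (v - 1) \<le> 1/4"
    if v: "v^2 * (z - p) = z - q" "Re v > 0" "8 * \<delta> \<le> dist z p" "dist p q \<le> 2 * \<delta>" for v z q
  proof -
    have zp: "norm (z - p) > 0" "norm (p - q) \<le> norm (z - p) / 4"
      using v assms by (auto simp: dist_norm)
    have "(v^2 - 1) * (z - p) = p - q" using v(1) by (simp add: algebra_simps)
    then have "norm (v^2 - 1) * norm (z - p) \<le> (1/4) * norm (z - p)"
      using zp by (metis norm_mult divide_inverse inverse_eq_divide mult.commute)
    then have "norm (v^2 - 1) \<le> 1/4" using zp by simp
    then show ?thesis using norm_diff_1_le_power2[of v] v by linarith
  qed
  have step: "R y" if R: "R x" "x \<notin> K" "dist p x \<le> \<delta>" and xy: "\<And>z. z \<in> K \<Longrightarrow> dist x y \<le> dist x z / 2" for x y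
  proof -
    obtain v where v: "poly_approx K v" "\<And>z. z\<in>K \<Longrightarrow> v z ^ 2 * (z - p) = z - x"
        "\<And>z. z\<in>K \<Longrightarrow> 8 * \<delta> \<le> dist z p \<Longrightarrow> Re (v z) > 0"
      using R(1) unfolding R_def by blast
    define u where "u z = (y - x) * (1 / (z - x))" for z
    have u: "norm (u z) \<le> 1/2" if "z \<in> K" for z
      using xy[OF that] R(2) that
      by (auto simp: u_def norm_mult norm_divide divide_simps dist_norm norm_minus_commute mult.commute)
    have "poly_approx K (\<lambda>z. csqrt (1 - u z))"
    proof (rule poly_approx_compose[OF assms(1) _ u csqrt_holomorphic])
      show "poly_approx K u" unfolding u_def
        using assms R by (intro poly_approx_cmult poly_approx_pole) auto
    qed
    then have "poly_approx K (\<lambda>z. v z * csqrt (1 - u z))"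
      by (intro poly_approx_mult v assms)
    moreover have "(v z * csqrt (1 - u z)) ^ 2 * (z - p) = z - y" if "z \<in> K" for z
    proof -
      have "z \<noteq> x" using R that by auto
      have "(v z * csqrt (1 - u z)) ^ 2 * (z - p) = (v z ^ 2 * (z - p)) * (1 - u z)"
        by (simp add: power_mult_distrib mult_ac)
      also have "\<dots> = (z - x) - (z - x) * u z"
        unfolding v(2)[OF that] by (simp add: right_diff_distrib)
      also have "(z - x) * u z = y - x" using \<open>z \<noteq> x\<close> by (simp add: u_def)
      also have "(z - x) - (y - x) = z - y" by simp
      finally show ?thesis .
    qed
    \<comment> \<open>The old root is within \<open>1/4\<close> of 1 and the new factor within \<open>1/2\<close>, so their product is less than 1 away from 1.\<close>
    moreover have "Re (v z * csqrt (1 - u z)) > 0" if z: "z \<in> K" "8 * \<delta> \<le> dist z p" for z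
    proof -
      have 1: "norm (v z - 1) \<le> 1/4"
        using near_1[OF v(2)[OF z(1)] v(3)[OF z] z(2)] R assms by simp
      have "0 \<le> Re (csqrt (1 - u z))"
        using csqrt_principal[of "1 - u z"] by linarith
      then have 2: "norm (csqrt (1 - u z) - 1) \<le> 1/2"
        using norm_diff_1_le_power2[of "csqrt (1 - u z)"] u[OF z(1)] by simp
      have "v z * csqrt (1 - u z) - 1 = (v z - 1) * (csqrt (1 - u z) - 1) + (v z - 1) + (csqrt (1 - u z) - 1)"
        by (simp add: algebra_simps)
      also have "norm \<dots> \<le> norm (v z - 1) * norm (csqrt (1 - u z) - 1) + norm (v z - 1) + norm (csqrt (1 - u z) - 1)"
        by (intro order_trans[OF norm_triangle_ineq] add_mono) (auto simp: norm_mult)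
      also have "\<dots> \<le> (1/4) * (1/2) + 1/4 + 1/2"
        using 1 2 by (intro add_mono mult_mono) auto
      finally have "norm (v z * csqrt (1 - u z) - 1) < 1" by simp
      then show ?thesis using abs_Re_le_cmod[of "v z * csqrt (1 - u z) - 1"] by simp
    qed
    ultimately show ?thesis unfolding R_def by (intro exI[of _ "\<lambda>z. v z * csqrt (1 - u z)"]) auto
  qed
  have "\<exists>q. R q \<and> \<delta> \<le> dist p q \<and> dist p q \<le> 2 * \<delta>"
  proof (rule ccontr)
    assume no: "\<not> ?thesis"
    obtain B where B: "K \<subseteq> ball p B"
      using assms(1) compact_imp_bounded bounded_subset_ballD by blast
    \<comment> \<open>a point outside \<open>K\<close> and outside the disc of radius \<open>\<delta>\<close> about \<open>p\<close>\<close>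
    define c where "c = p + of_real (max B \<delta>)"
    have c: "dist p c = max B \<delta>" using assms by (simp add: c_def dist_norm)
    then have "c \<notin> K" using B by (auto simp: subset_iff)
    have "R c \<and> dist p c < \<delta>"
    proof (rule complement_induct[OF assms(1,2,3) _ \<open>c \<notin> K\<close> assms(4)])
      show "R p \<and> dist p p < \<delta>"
        unfolding R_def using assms(4) poly_approx_const[of K 1] by (intro conjI exI[of _ "\<lambda>z. 1"]) simp_all
    next
      fix x y assume *: "x \<notin> K" "R x \<and> dist p x < \<delta>" "dist x y \<le> \<delta>" "\<And>z. z \<in> K \<Longrightarrow> dist x y \<le> dist x z / 2"
      have "R y" by (rule step[of x y]) (use * in auto)
      moreover have "dist p y \<le> 2 * \<delta>" using * dist_triangle[of p y x] by simp
      ultimately show "R y \<and> dist p y < \<delta>" using no by force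
    qed
    then show False using c by simp
  qed
  then obtain q v where q: "\<delta> \<le> dist p q" "dist p q \<le> 2 * \<delta>" and v: "poly_approx K v"
      "\<And>z. z\<in>K \<Longrightarrow> v z ^ 2 * (z - p) = z - q" "\<And>z. z\<in>K \<Longrightarrow> 8 * \<delta> \<le> dist z p \<Longrightarrow> Re (v z) > 0"
    unfolding R_def by blast
  show thesis
  proof (rule that[OF q])
    show "poly_approx K (\<lambda>z. (z - p) * v z)"
      by (intro poly_approx_mult poly_approx_diff poly_approx_ident poly_approx_const v assms)
    show "((z - p) * v z)\<^sup>2 = (z - p) * (z - q)" if "z \<in> K" for z
      using v(2)[OF that] by (simp add: power_mult_distrib power2_eq_square mult_ac)
    show "cmod ((z - p) * v z - (z - p)) \<le> dist z p / 4" if z: "z \<in> K" "8 * \<delta> \<le> dist z p" for z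
    proof -
      have "norm (v z - 1) \<le> 1/4" using near_1[OF v(2)[OF z(1)] v(3)[OF z] z(2)] q by simp
      then have "norm (z - p) * norm (v z - 1) \<le> norm (z - p) * (1/4)" by (intro mult_left_mono) auto
      moreover have "(z - p) * v z - (z - p) = (z - p) * (v z - 1)" by (simp add: algebra_simps)
      ultimately show ?thesis by (simp add: norm_mult dist_norm)
    qed
  qed
qed

text \<open>
  Put \<open>w = z - c\<close> for the midpoint \<open>c\<close> of \<open>p\<close> and \<open>q\<close>, let \<open>d = q - p\<close>, and let \<open>s\<close> be the square root of \<open>w^2 - d^2/4\<close>
  from \<open>poly_approx_sqrt\<close>. Then \<open>(w - s) * (w + s) = d^2/4\<close>, so that a multiple \<open>g\<close> of \<open>w - s\<close> equals \<open>2 / (w + s)\<close>.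
  The first form is bounded near \<open>p\<close>; the second shows the behaviour of \<open>1/w\<close> far away. The symmetry about \<open>c\<close> removes the term
  of order \<open>1/w^2\<close> from \<open>g - 1/w\<close>.
\<close>
lemma sqrt_kernel:
  assumes "compact K" "connected (- K)" "p \<notin> K" "\<delta> > 0"
  obtains c g where "dist p c \<le> \<delta>" "poly_approx K g"
    "\<And>z. z \<in> K \<Longrightarrow> norm (g z) \<le> 144 / \<delta>"
    "\<And>z. z \<in> K \<Longrightarrow> 8 * \<delta> \<le> dist z p \<Longrightarrow> norm (g z) \<le> 2 / dist z p"
    "\<And>z. z \<in> K \<Longrightarrow> 8 * \<delta> \<le> dist z p \<Longrightarrow> norm (g z - 1 / (z - c)) \<le> \<delta>^2 / dist z p ^ 3"
proof -
  obtain q s where q: "\<delta> \<le> dist p q" "dist p q \<le> 2 * \<delta>" and s: "poly_approx K s"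
    "\<And>z. z \<in> K \<Longrightarrow> s z ^ 2 = (z - p) * (z - q)"
    "\<And>z. z \<in> K \<Longrightarrow> 8 * \<delta> \<le> dist z p \<Longrightarrow> norm (s z - (z - p)) \<le> dist z p / 4"
    using poly_approx_sqrt[OF assms] by blast
  define c where "c = (p + q) / 2"
  define d where "d = q - p"
  define g where "g z = (8 / d^2) * (z - c - s z)" for z
  have d: "\<delta> \<le> norm d" "norm d \<le> 2 * \<delta>" "d \<noteq> 0"
    using q assms by (auto simp: d_def dist_norm norm_minus_commute)
  have pc: "norm (p - c) \<le> \<delta>"
  proof -
    have "p - c = - d / 2" by (simp add: c_def d_def field_simps)
    then have "norm (p - c) = norm d / 2" by (simp add: norm_divide)
    then show ?thesis using d by simp
  qed
  have prod: "(z - c - s z) * (z - c + s z) = d^2 / 4" if "z \<in> K" for z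
  proof -
    have "(z - c - s z) * (z - c + s z) = (z - c)^2 - s z ^ 2" by (simp add: power2_eq_square algebra_simps)
    also have "\<dots> = d^2 / 4" unfolding s(2)[OF that] c_def d_def by (simp add: power2_eq_square field_simps)
    finally show ?thesis .
  qed
  have far: "norm (g z) \<le> 2 / dist z p \<and> norm (g z - 1 / (z - c)) \<le> \<delta>^2 / dist z p ^ 3"
    if z: "z \<in> K" "8 * \<delta> \<le> dist z p" for z
  proof -
    define X where "X = norm (z - p)"
    have X: "X > 0" "\<delta> \<le> X / 8" using z assms by (auto simp: X_def dist_norm)
    define m where "m = z - c + s z"
    have "norm (2 * (z - p)) \<le> norm m + norm (s z - (z - p)) + norm (p - c)"
    proof -
      have "2 * (z - p) = m - (s z - (z - p)) - (p - c)" by (simp add: m_def)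
      then show ?thesis by (metis norm_triangle_ineq4 add_right_mono order_trans)
    qed
    moreover have "norm (s z - (z - p)) \<le> X / 4" using s(3)[OF z] by (simp add: X_def dist_norm)
    moreover have "norm (2 * (z - p)) = 2 * X" by (metis norm_mult norm_numeral X_def)
    ultimately have m: "13/8 * X \<le> norm m" using pc X by linarith
    have w: "7/8 * X \<le> norm (z - c)"
      using norm_triangle_ineq4[of "z - c" "p - c"] pc X by (simp add: X_def)
    have nz: "m \<noteq> 0" "z - c \<noteq> 0" using m w X by auto
    have "(z - c - s z) * m = d^2 / 4" unfolding m_def by (rule prod[OF z(1)])
    then have A: "z - c - s z = d^2 / (4 * m)" using nz by (simp add: field_simps)
    then have gm: "g z = 2 / m" using d by (simp add: g_def)
    have "norm (g z) = 2 / norm m" by (simp add: gm norm_divide)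
    also have "\<dots> \<le> 2 / X" using m X nz by (intro divide_left_mono) auto
    finally have 1: "norm (g z) \<le> 2 / X" .
    have "g z - 1 / (z - c) = (2 * (z - c) - m) / (m * (z - c))"
      using nz by (simp add: gm field_simps)
    also have "2 * (z - c) - m = z - c - s z" by (simp add: m_def)
    also note A
    finally have "norm (g z - 1 / (z - c)) = norm d ^ 2 / (4 * norm m ^ 2 * norm (z - c))"
      by (simp add: norm_divide norm_mult norm_power power2_eq_square)
    also have "\<dots> \<le> (2 * \<delta>)^2 / (4 * (13/8 * X)^2 * (7/8 * X))"
      using d m w X nz by (intro frac_le mult_mono power_mono) auto
    also have "\<dots> = (\<delta>^2 / X^3) * (512/1183)"
      using X by (simp add: power2_eq_square power3_eq_cube field_simps)
    also have "\<dots> \<le> \<delta>^2 / X^3"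
      using X by (intro mult_left_le) auto
    finally show ?thesis using 1 by (simp add: X_def dist_norm)
  qed
  have bound: "norm (g z) \<le> 144 / \<delta>" if z: "z \<in> K" for z
  proof (cases "8 * \<delta> \<le> dist z p")
    case True
    have "0 < dist z p" using True assms(4) by linarith
    then have "2 / dist z p \<le> 2 / (8 * \<delta>)" using True assms(4) by (intro divide_left_mono mult_pos_pos) auto
    also have "\<dots> \<le> 144 / \<delta>" using assms by (simp add: field_simps)
    finally show ?thesis using far[OF z True] by linarith
  next
    case False
    then have zp: "norm (z - p) \<le> 8 * \<delta>" by (simp add: dist_norm)
    have "norm (z - q) \<le> norm (z - p) + norm (p - q)"
      by (metis diff_add_cancel diff_diff_eq2 norm_triangle_ineq add.commute add_diff_eq)
    then have zq: "norm (z - q) \<le> 10 * \<delta>" using zp q by (simp add: dist_norm)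
    have "norm (s z) ^ 2 = norm (z - p) * norm (z - q)" by (metis s(2)[OF z] norm_mult norm_power)
    also have "\<dots> \<le> (8 * \<delta>) * (10 * \<delta>)" using zp zq assms by (intro mult_mono) auto
    also have "\<dots> \<le> (9 * \<delta>)^2" by (simp add: power2_eq_square)
    finally have sz: "norm (s z) \<le> 9 * \<delta>" by (rule power2_le_imp_le) (use assms in auto)
    have "norm (z - c) \<le> norm (z - p) + norm (p - c)"
      by (metis diff_add_cancel diff_diff_eq2 norm_triangle_ineq add.commute add_diff_eq)
    then have "norm (z - c - s z) \<le> 18 * \<delta>"
      using norm_triangle_ineq4[of "z - c" "s z"] zp pc sz by linarith
    then have "norm (g z) \<le> (8 / \<delta>^2) * (18 * \<delta>)"
      unfolding g_def norm_mult using d assms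
      by (intro mult_mono) (auto simp: norm_divide norm_power intro!: divide_left_mono power_mono)
    also have "\<dots> = 144 / \<delta>" using assms by (simp add: power2_eq_square)
    finally show ?thesis .
  qed
  show thesis
  proof (rule that[of c g])
    show "poly_approx K g" unfolding g_def
      by (intro poly_approx_cmult poly_approx_diff poly_approx_ident poly_approx_const s assms)
  qed (use pc far bound in \<open>auto simp: dist_norm\<close>)
qed

text \<open>
  Powers of \<open>1 / (z - \<zeta>)\<close> are expanded around the centre \<open>c\<close> of the kernel \<open>g\<close> of \<open>sqrt_kernel\<close>: with \<open>w = z - c\<close> and \<open>t = \<zeta> - c\<close>,
  \<open>1 / (z - \<zeta>) = 1/w + t/w^2 + O(\<delta>^2/w^3)\<close>, and \<open>g\<close> takes the place of \<open>1/w\<close>. The numerical constants are crude.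
\<close>
lemma kernels_at_point:
  assumes "compact K" "connected (- K)" "p \<notin> K" "\<delta> > 0" "dist p \<zeta> \<le> 2 * \<delta>"
  obtains G1 G2 where "poly_approx K G1" "poly_approx K G2"
    "\<And>z. z \<in> K \<Longrightarrow> norm (G1 z) \<le> 70000 / \<delta>"
    "\<And>z. z \<in> K \<Longrightarrow> norm (G2 z) \<le> 30000 / \<delta>^2"
    "\<And>z. z \<in> K \<Longrightarrow> 10 * \<delta> \<le> dist z \<zeta> \<Longrightarrow> norm (G1 z - 1 / (z - \<zeta>)) \<le> 26 * \<delta>^2 / dist z \<zeta> ^ 3"
    "\<And>z. z \<in> K \<Longrightarrow> 10 * \<delta> \<le> dist z \<zeta> \<Longrightarrow> norm (G2 z - 1 / (z - \<zeta>)^2) \<le> 13 * \<delta> / dist z \<zeta> ^ 3"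
proof -
  obtain c g where c: "dist p c \<le> \<delta>" and g: "poly_approx K g"
    "\<And>z. z \<in> K \<Longrightarrow> norm (g z) \<le> 144 / \<delta>"
    "\<And>z. z \<in> K \<Longrightarrow> 8 * \<delta> \<le> dist z p \<Longrightarrow> norm (g z) \<le> 2 / dist z p"
    "\<And>z. z \<in> K \<Longrightarrow> 8 * \<delta> \<le> dist z p \<Longrightarrow> norm (g z - 1 / (z - c)) \<le> \<delta>^2 / dist z p ^ 3"
    using sqrt_kernel[OF assms(1-4)] by blast
  define t where "t = \<zeta> - c"
  have t: "norm t \<le> 3 * \<delta>"
    using dist_triangle[of c \<zeta> p] c assms(5) by (simp add: t_def dist_norm norm_minus_commute)
  have G2: "norm (g z ^ 2) \<le> 30000 / \<delta>^2" if "z \<in> K" for z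
  proof -
    have "norm (g z) ^ 2 \<le> (144 / \<delta>) ^ 2" using g(2)[OF that] by (intro power_mono) auto
    also have "\<dots> \<le> 30000 / \<delta>^2" by (simp add: power_divide divide_right_mono)
    finally show ?thesis by (simp add: norm_power)
  qed
  have far: "norm (g z + t * g z ^ 2 - 1 / (z - \<zeta>)) \<le> 26 * \<delta>^2 / dist z \<zeta> ^ 3 \<and>
             norm (g z ^ 2 - 1 / (z - \<zeta>)^2) \<le> 13 * \<delta> / dist z \<zeta> ^ 3"
    if z: "z \<in> K" "10 * \<delta> \<le> dist z \<zeta>" for z
  proof -
    define y w Y where "y = z - \<zeta>" and "w = z - c" and "Y = norm y"
    have Y: "Y > 0" "\<delta> \<le> Y / 10" using z assms by (auto simp: Y_def y_def dist_norm)
    have nx: "8/10 * Y \<le> dist z p"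
      using dist_triangle[of z \<zeta> p] assms(5) Y by (simp add: Y_def y_def dist_norm)
    then have x8: "8 * \<delta> \<le> dist z p" using Y by linarith
    have y: "y = w - t" by (simp add: y_def w_def t_def)
    then have nw: "7/10 * Y \<le> norm w"
      using norm_triangle_ineq4[of w t] t Y by (simp add: Y_def)
    have nz: "y \<noteq> 0" "w \<noteq> 0" using Y nw by (auto simp: Y_def)
    have g0: "norm (g z) \<le> 5/2 / Y"
    proof -
      have "2 / dist z p \<le> 2 / (8/10 * Y)" using nx Y by (intro divide_left_mono mult_pos_pos) auto
      then show ?thesis using g(3)[OF z(1) x8] by simp
    qed
    have g1: "norm (g z - 1 / w) \<le> 2 * \<delta>^2 / Y^3"
    proof -
      have "\<delta>^2 / dist z p ^ 3 \<le> \<delta>^2 / (8/10 * Y)^3"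
        using nx Y by (intro divide_left_mono mult_pos_pos zero_less_power power_mono) auto
      also have "\<dots> = (\<delta>^2 / Y^3) * (125/64)" using Y by (simp add: power3_eq_cube)
      also have "\<dots> \<le> (\<delta>^2 / Y^3) * 2" using Y by (intro mult_left_mono) auto
      finally show ?thesis using g(4)[OF z(1) x8] by (simp add: w_def mult.commute)
    qed
    have w1: "norm (1 / w) \<le> 3/2 / Y"
    proof -
      have "1 / norm w \<le> 1 / (7/10 * Y)" using nw Y by (intro divide_left_mono mult_pos_pos) auto
      also have "\<dots> \<le> 3/2 / Y" using Y by (simp add: divide_simps)
      finally show ?thesis by (simp add: norm_divide)
    qed
    have g2: "norm (g z ^ 2 - 1 / w ^ 2) \<le> \<delta> / Y^3"
    proof -
      have "g z ^ 2 - 1 / w ^ 2 = (g z - 1 / w) * (g z + 1 / w)"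
        by (simp add: power2_eq_square algebra_simps)
      also have "norm \<dots> \<le> (2 * \<delta>^2 / Y^3) * (5/2 / Y + 3/2 / Y)"
        unfolding norm_mult using g1 g0 w1 Y
        by (intro mult_mono order_trans[OF norm_triangle_ineq] add_mono) auto
      also have "\<dots> = (\<delta> / Y^3) * (8 * \<delta> / Y)" using Y by (simp add: power2_eq_square field_simps)
      also have "\<dots> \<le> (\<delta> / Y^3) * 1" using Y assms(4) by (intro mult_left_mono) auto
      finally show ?thesis by simp
    qed
    have inv: "1/w - 1/y = - t * (1/w) * (1/y)"
      using nz by (simp add: y field_simps)
    have wy: "norm (1 / w^2 - 1 / y^2) \<le> 12 * \<delta> / Y^3"
    proof -
      have y1: "norm (1 / y) \<le> 1 / Y" by (simp add: norm_divide Y_def)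
      have p1: "norm ((1/w) * (1/y) * (1/y)) \<le> (3/2 / Y) * (1/Y) * (1/Y)"
        unfolding norm_mult using w1 y1 Y by (intro mult_mono) auto
      have p2: "norm ((1/w) * (1/w) * (1/y)) \<le> (3/2 / Y) * (3/2 / Y) * (1/Y)"
        unfolding norm_mult using w1 y1 Y by (intro mult_mono) auto
      have "1 / w^2 - 1 / y^2 = (1/w - 1/y) * (1/w + 1/y)"
        by (simp add: power2_eq_square algebra_simps)
      also have "\<dots> = - t * ((1/w) * (1/y) * (1/y) + (1/w) * (1/w) * (1/y))"
        unfolding inv by (simp add: algebra_simps)
      also have "norm \<dots> \<le> (3 * \<delta>) * ((3/2 / Y) * (1/Y) * (1/Y) + (3/2 / Y) * (3/2 / Y) * (1/Y))"
        unfolding norm_mult[of "- t"] norm_minus_cancel using t p1 p2 Y assms(4)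
        by (intro mult_mono order_trans[OF norm_triangle_ineq] add_mono) auto
      also have "\<dots> = (\<delta> / Y^3) * (45/4)" using Y by (simp add: power3_eq_cube field_simps)
      also have "\<dots> \<le> (\<delta> / Y^3) * 12" using Y assms(4) by (intro mult_left_mono) auto
      finally show ?thesis by (simp add: mult.commute)
    qed
    have A: "norm (g z ^ 2 - 1 / y ^ 2) \<le> 13 * \<delta> / Y ^ 3"
      using norm_triangle_ineq[of "g z ^ 2 - 1 / w ^ 2" "1 / w^2 - 1 / y^2"] g2 wy by simp
    have "norm (t^2 * ((1/w) * (1/w) * (1/y))) \<le> (3 * \<delta>)^2 * ((3/2 / Y) * (3/2 / Y) * (1/Y))"
      unfolding norm_mult norm_power using t w1 Y assms(4)
      by (intro mult_mono power_mono) (auto simp: norm_divide Y_def[symmetric])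
    also have "\<dots> = (\<delta>^2 / Y^3) * (81/4)" using Y by (simp add: power3_eq_cube power2_eq_square field_simps)
    also have "\<dots> \<le> (\<delta>^2 / Y^3) * 21" using Y assms(4) by (intro mult_left_mono) auto
    finally have 3: "norm (t^2 * ((1/w) * (1/w) * (1/y))) \<le> 21 * (\<delta>^2 / Y^3)" by (simp only: mult.commute)
    have 2: "norm (t * (g z ^ 2 - 1 / w ^ 2)) \<le> 3 * (\<delta>^2 / Y^3)"
    proof -
      have "norm t * norm (g z ^ 2 - 1 / w ^ 2) \<le> (3 * \<delta>) * (\<delta> / Y^3)"
        using t g2 assms(4) by (intro mult_mono) auto
      then show ?thesis unfolding norm_mult by (simp add: power2_eq_square)
    qed
    have "g z + t * g z ^ 2 - 1 / y = (g z - 1 / w) + t * (g z ^ 2 - 1 / w ^ 2) - t^2 * ((1/w) * (1/w) * (1/y))"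
    proof -
      define r where "r = t^2 * ((1/w) * (1/w) * (1/y))"
      have once: "1 / y = 1 / w + t * (1/w) * (1/y)" using inv by (simp add: algebra_simps)
      also have "\<dots> = 1 / w + t * (1/w) * (1 / w + t * (1/w) * (1/y))"
        using once by (rule arg_cong)
      also have "\<dots> = 1 / w + t / w ^ 2 + r"
        by (simp add: r_def power2_eq_square distrib_left mult_ac)
      finally show ?thesis unfolding r_def[symmetric] by (simp add: right_diff_distrib)
    qed
    also have "norm \<dots> \<le> norm (g z - 1 / w) + norm (t * (g z ^ 2 - 1 / w ^ 2)) + norm (t^2 * ((1/w) * (1/w) * (1/y)))"
      by (intro order_trans[OF norm_triangle_ineq4] add_mono norm_triangle_ineq order_refl)
    also have "\<dots> \<le> 26 * (\<delta>^2 / Y^3)" using g1 2 3 by simp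
    finally show ?thesis using A by (simp add: y_def Y_def dist_norm)
  qed
  show thesis
  proof (rule that[of "\<lambda>z. g z + t * g z ^ 2" "\<lambda>z. g z ^ 2"])
    show "norm (g z + t * g z ^ 2) \<le> 70000 / \<delta>" if z: "z \<in> K" for z
    proof -
      have "norm t * norm (g z) ^ 2 \<le> (3 * \<delta>) * (144 / \<delta>)^2"
        using t g(2)[OF z] assms(4) by (intro mult_mono power_mono) auto
      also have "\<dots> = 62208 / \<delta>" using assms(4) by (simp add: power2_eq_square field_simps)
      finally have "norm (t * g z ^ 2) \<le> 62208 / \<delta>" by (simp add: norm_mult norm_power)
      then have "norm (g z + t * g z ^ 2) \<le> 144 / \<delta> + 62208 / \<delta>"
        using g(2)[OF z] norm_triangle_ineq[of "g z" "t * g z ^ 2"] by linarith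
      also have "\<dots> \<le> 70000 / \<delta>" using assms(4) by (simp add: field_simps)
      finally show ?thesis .
    qed
  qed (use far G2 g in \<open>auto intro!: poly_approx_add poly_approx_cmult poly_approx_power assms\<close>)
qed

section \<open>Contour integrals over squares\<close>

text \<open>
  An alternating sum over the four edges, instead of the contour integral along \<^term>\<open>rectpath a b\<close>: it is additive over a
  grid even when the integrand is singular on an inner edge, since the two contributions of that edge
  cancel whatever their value.
\<close>
definition rect_integral :: "(complex \<Rightarrow> complex) \<Rightarrow> complex \<Rightarrow> complex \<Rightarrow> complex" where
  "rect_integral u a b =
     contour_integral (linepath a (Complex (Re b) (Im a))) u
   + contour_integral (linepath (Complex (Re b) (Im a)) b) u
   - contour_integral (linepath (Complex (Re a) (Im b)) b) u
   - contour_integral (linepath a (Complex (Re a) (Im b))) u"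

lemma rectpath_edges:
  "path_image (rectpath a b) = closed_segment a (Complex (Re b) (Im a)) \<union> closed_segment (Complex (Re b) (Im a)) b
     \<union> closed_segment (Complex (Re a) (Im b)) b \<union> closed_segment a (Complex (Re a) (Im b))"
  by (auto simp: rectpath_def Let_def path_image_join closed_segment_commute)

lemma has_contour_integral_rectpath:
  assumes "continuous_on (path_image (rectpath a b)) u"
  shows "(u has_contour_integral rect_integral u a b) (rectpath a b)"
proof -
  define a2 a4 where "a2 = Complex (Re b) (Im a)" and "a4 = Complex (Re a) (Im b)"
  have c: "continuous_on (closed_segment a a2) u" "continuous_on (closed_segment a2 b) u"
     "continuous_on (closed_segment a4 b) u" "continuous_on (closed_segment a a4) u"
    using assms by (auto simp: rectpath_edges a2_def a4_def intro: continuous_on_subset)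
  have h: "(u has_contour_integral contour_integral (linepath x y) u) (linepath x y)"
    if "continuous_on (closed_segment x y) u" for x y
    using that by (simp add: contour_integrable_continuous_linepath has_contour_integral_integral)
  have r: "(u has_contour_integral - contour_integral (linepath x y) u) (linepath y x)"
    if "continuous_on (closed_segment x y) u" for x y
    using has_contour_integral_reversepath[OF _ h[OF that]] by simp
  have "(u has_contour_integral contour_integral (linepath a a2) u + (contour_integral (linepath a2 b) u
      + (- contour_integral (linepath a4 b) u + - contour_integral (linepath a a4) u)))
      (linepath a a2 +++ linepath a2 b +++ linepath b a4 +++ linepath a4 a)"
    by (intro has_contour_integral_join h r c valid_path_join) auto
  then show ?thesis by (simp add: rect_integral_def rectpath_def Let_def a2_def a4_def algebra_simps)
qed

lemma rect_integral_eq: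
  assumes "continuous_on (path_image (rectpath a b)) u"
  shows "contour_integral (rectpath a b) u = rect_integral u a b"
  using has_contour_integral_rectpath[OF assms] by (rule contour_integral_unique)

lemma rect_integral_bound:
  assumes "d > 0" "B \<ge> 0" "continuous_on (path_image (rectpath a (a + Complex d d))) u"
    and "\<And>x. x \<in> path_image (rectpath a (a + Complex d d)) \<Longrightarrow> norm (u x) \<le> B"
  shows "norm (rect_integral u a (a + Complex d d)) \<le> 4 * d * B"
proof -
  define b where "b = a + Complex d d"
  have e: "norm (contour_integral (linepath x y) u) \<le> B * d"
    if "closed_segment x y \<subseteq> path_image (rectpath a b)" "norm (y - x) = d" for x y
  proof -
    have "norm (contour_integral (linepath x y) u) \<le> B * norm (y - x)"
      using that(1) assms unfolding b_def
      by (intro contour_integral_bound_linepath contour_integrable_continuous_linepath)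
         (auto intro: continuous_on_subset)
    then show ?thesis by (simp add: that)
  qed
  have n: "norm (Complex (Re b) (Im a) - a) = d" "norm (b - Complex (Re b) (Im a)) = d"
    "norm (b - Complex (Re a) (Im b)) = d" "norm (Complex (Re a) (Im b) - a) = d"
    using assms(1) by (simp_all add: b_def cmod_def)
  have "norm (rect_integral u a b) \<le> B * d + B * d + B * d + B * d"
    unfolding rect_integral_def
    by (intro order_trans[OF norm_triangle_ineq4] order_trans[OF norm_triangle_ineq] add_mono e n)
       (auto simp: rectpath_edges)
  then show ?thesis by (simp add: b_def algebra_simps)
qed

lemma norm_diff_corner_le:
  assumes "x \<in> cbox a (a + Complex d d)"
  shows "norm (x - a) \<le> 2 * d"
  using assms cmod_le[of "x - a"] by (auto simp: in_cbox_complex_iff)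

text \<open>
  With \<open>y = z - a\<close>, expanding \<open>1 / (x - z)\<close> in \<open>x - a\<close> shows that the integral is \<open>- M0/y - M1/y^2 + O(\<omega> * (d/y)^3)\<close>, where
  \<open>M0\<close> and \<open>M1\<close> are the moments of \<open>f - f a\<close> along the boundary. If the square lies in the interior of \<open>K\<close>, the integral
  vanishes and \<open>F = 0\<close> does. Otherwise there is a point outside \<open>K\<close> within \<open>2 * d\<close> of \<open>a\<close>, and
  \<open>1/y\<close> and \<open>1/y^2\<close> are replaced by functions that remain bounded near the square.
\<close>
lemma square_approx:
  assumes K: "compact K" "connected (- K)" and "d > 0" "\<omega> \<ge> 0"
    and f: "continuous_on UNIV f" "f holomorphic_on interior K"
    and osc: "\<And>x. x \<in> cbox a (a + Complex d d) \<Longrightarrow> norm (f x - f a) \<le> \<omega>"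
  obtains F where "poly_approx K F" "\<And>z. z \<in> K \<Longrightarrow> norm (F z) \<le> 600000 * \<omega>"
    "\<And>z. z \<in> K \<Longrightarrow> 10 * d \<le> dist z a \<Longrightarrow>
       norm (rect_integral (\<lambda>x. f x / (x - z)) a (a + Complex d d) + F z) \<le> 250 * \<omega> * (d / dist z a) ^ 3"
proof -
  define b where "b = a + Complex d d"
  define \<Gamma> where "\<Gamma> = rectpath a b"
  have \<Gamma>: "path_image \<Gamma> \<subseteq> cbox a b" "valid_path \<Gamma>" "pathfinish \<Gamma> = pathstart \<Gamma>"
    using path_image_rectpath_subset_cbox[of a b] \<open>d > 0\<close> by (auto simp: \<Gamma>_def b_def)
  have cont: "continuous_on (path_image \<Gamma>) f" using f(1) continuous_on_subset by blast
  show thesis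
  proof (cases "cbox a b \<subseteq> interior K")
    case True
    have "rect_integral (\<lambda>x. f x / (x - z)) a b = 0" if "z \<in> K" "10 * d \<le> dist z a" for z
    proof -
      have z: "z \<notin> cbox a b" using norm_diff_corner_le[of z a d] that \<open>d > 0\<close> by (auto simp: b_def dist_norm)
      have "((\<lambda>x. f x / (x - z)) has_contour_integral 0) \<Gamma>"
      proof (rule Cauchy_theorem_convex_simple[OF _ convex_box(1)])
        show "(\<lambda>x. f x / (x - z)) holomorphic_on cbox a b"
          using z by (intro holomorphic_intros holomorphic_on_subset[OF f(2) True]) auto
      qed (use \<Gamma> in auto)
      moreover have "continuous_on (path_image \<Gamma>) (\<lambda>x. f x / (x - z))"
        using z \<Gamma>(1) by (intro continuous_intros cont) auto
      ultimately show ?thesis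
        using rect_integral_eq[of a b] contour_integral_unique unfolding \<Gamma>_def by metis
    qed
    then show thesis using that[of "\<lambda>z. 0"] assms(3,4) poly_approx_const[of K 0] by (simp add: b_def)
  next
    case False
    obtain x where x: "x \<in> cbox a b" "x \<notin> interior K" using False by blast
    have "\<not> ball x (d/2) \<subseteq> K" using x(2) \<open>d > 0\<close> by (auto simp: mem_interior)
    then obtain p where p: "dist x p < d/2" "p \<notin> K" by (metis subsetI mem_ball)
    have "norm (x - a) \<le> 3/2 * d"
    proof (rule power2_le_imp_le)
      have "norm (x - a) ^ 2 = (Re x - Re a)^2 + (Im x - Im a)^2" by (simp add: cmod_power2)
      also have "\<dots> \<le> d^2 + d^2"
        using x(1) by (intro add_mono power_mono) (auto simp: b_def in_cbox_complex_iff)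
      also have "\<dots> \<le> (3/2 * d)^2" by (simp add: power2_eq_square)
      finally show "norm (x - a) ^ 2 \<le> (3/2 * d)^2" .
    qed (use \<open>d > 0\<close> in auto)
    then have "dist p a \<le> 2 * d"
      using p dist_triangle[of p a x] by (simp add: dist_norm norm_minus_commute)
    then obtain G1 G2 where G: "poly_approx K G1" "poly_approx K G2"
      "\<And>z. z \<in> K \<Longrightarrow> norm (G1 z) \<le> 70000 / d"
      "\<And>z. z \<in> K \<Longrightarrow> norm (G2 z) \<le> 30000 / d^2"
      "\<And>z. z \<in> K \<Longrightarrow> 10 * d \<le> dist z a \<Longrightarrow> norm (G1 z - 1 / (z - a)) \<le> 26 * d^2 / dist z a ^ 3"
      "\<And>z. z \<in> K \<Longrightarrow> 10 * d \<le> dist z a \<Longrightarrow> norm (G2 z - 1 / (z - a)^2) \<le> 13 * d / dist z a ^ 3"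
      using kernels_at_point[OF K p(2) \<open>d > 0\<close>] by blast
    define h0 h1 where "h0 x = f x - f a" and "h1 x = (x - a) * (f x - f a)" for x
    have ch: "continuous_on (path_image \<Gamma>) h0" "continuous_on (path_image \<Gamma>) h1"
      unfolding h0_def h1_def by (intro continuous_intros cont)+
    define M0 M1 where "M0 = rect_integral h0 a b" and "M1 = rect_integral h1 a b"
    have h0: "norm (h0 x) \<le> \<omega>" if "x \<in> cbox a b" for x
      using osc that by (simp add: h0_def b_def)
    have h1: "norm (h1 x) \<le> 2 * d * \<omega>" if "x \<in> cbox a b" for x
      unfolding h1_def norm_mult using osc norm_diff_corner_le[of x a d] that \<open>d > 0\<close>
      by (intro mult_mono) (auto simp: b_def)
    have M0: "norm M0 \<le> 4 * d * \<omega>"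
      using rect_integral_bound[of d \<omega> a h0] ch(1) h0 \<Gamma>(1) \<open>d > 0\<close> \<open>\<omega> \<ge> 0\<close>
      unfolding M0_def b_def \<Gamma>_def by blast
    have M1: "norm M1 \<le> 4 * d * (2 * d * \<omega>)"
      using rect_integral_bound[of d "2 * d * \<omega>" a h1] ch(2) h1 \<Gamma>(1) \<open>d > 0\<close> \<open>\<omega> \<ge> 0\<close>
      unfolding M1_def b_def \<Gamma>_def by (simp add: subset_iff)
    define F where "F z = M0 * G1 z + M1 * G2 z" for z
    show thesis
    proof (rule that[of F])
      show "poly_approx K F" unfolding F_def by (intro poly_approx_add poly_approx_cmult G K)
      show "norm (F z) \<le> 600000 * \<omega>" if "z \<in> K" for z
      proof -
        have "norm (F z) \<le> norm M0 * norm (G1 z) + norm M1 * norm (G2 z)"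
          unfolding F_def by (metis norm_mult norm_triangle_ineq)
        also have "\<dots> \<le> (4 * d * \<omega>) * (70000 / d) + (4 * d * (2 * d * \<omega>)) * (30000 / d^2)"
          using M0 M1 G(3,4)[OF that] \<open>d > 0\<close> \<open>\<omega> \<ge> 0\<close> by (intro add_mono mult_mono) auto
        also have "\<dots> \<le> 600000 * \<omega>" using \<open>d > 0\<close> \<open>\<omega> \<ge> 0\<close> by (simp add: power2_eq_square)
        finally show ?thesis .
      qed
      show "norm (rect_integral (\<lambda>x. f x / (x - z)) a (a + Complex d d) + F z) \<le> 250 * \<omega> * (d / dist z a) ^ 3"
        if z: "z \<in> K" "10 * d \<le> dist z a" for z
      proof -
        define y Y where "y = z - a" and "Y = dist z a"
        have Y: "Y > 0" "d \<le> Y / 10" "norm y = Y" using z \<open>d > 0\<close> by (auto simp: Y_def y_def dist_norm)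
        have zb: "z \<notin> cbox a b" using norm_diff_corner_le[of z a d] z \<open>d > 0\<close> by (auto simp: b_def dist_norm)
        \<comment> \<open>remainder of the expansion \<open>1 / (x - z) = - 1/y - (x - a)/y^2 + (x - a)^2 / (y^2 * (x - z))\<close>\<close>
        define err where "err x = h0 x * (x - a)^2 / (y^2 * (x - z))" for x
        have ce: "continuous_on (path_image \<Gamma>) err"
          unfolding err_def using zb \<Gamma>(1) Y by (intro continuous_intros ch) auto
        have errb: "norm (err x) \<le> 5 * \<omega> * d^2 / Y^3" if x: "x \<in> cbox a b" for x
        proof -
          have xa: "norm (x - a) \<le> 2 * d" using norm_diff_corner_le[of x a d] x by (simp add: b_def)
          have "norm (x - z) = norm (y - (x - a))" by (simp add: y_def norm_minus_commute)
          then have xz: "8/10 * Y \<le> norm (x - z)"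
            using norm_triangle_ineq2[of y "x - a"] xa Y by linarith
          have "norm (err x) = norm (h0 x) * norm (x - a)^2 / (Y^2 * norm (x - z))"
            by (simp add: err_def norm_mult norm_divide norm_power Y)
          also have "\<dots> \<le> \<omega> * (2 * d)^2 / (Y^2 * (8/10 * Y))"
            using h0[OF x] xa xz Y \<open>\<omega> \<ge> 0\<close> by (intro frac_le mult_mono power_mono mult_pos_pos) auto
          also have "\<dots> = 5 * \<omega> * d^2 / Y^3" using Y by (simp add: power2_eq_square power3_eq_cube)
          finally show ?thesis .
        qed
        have "norm (rect_integral err a b) \<le> 4 * d * (5 * \<omega> * d^2 / Y^3)"
          using rect_integral_bound[of d "5 * \<omega> * d^2 / Y^3" a err] ce errb \<Gamma>(1) \<open>d > 0\<close> \<open>\<omega> \<ge> 0\<close> Y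
          unfolding b_def \<Gamma>_def by (simp add: subset_iff)
        then have E: "norm (rect_integral err a b) \<le> 20 * (\<omega> * (d / Y)^3)"
          by (simp add: power_divide power2_eq_square power3_eq_cube mult_ac)
        have "((\<lambda>x. f a / (x - z)) has_contour_integral 0) \<Gamma>"
        proof (rule Cauchy_theorem_convex_simple[OF _ convex_box(1)])
          show "(\<lambda>x. f a / (x - z)) holomorphic_on cbox a b"
            using zb by (intro holomorphic_intros) auto
        qed (use \<Gamma> in auto)
        moreover have "(h0 has_contour_integral M0) \<Gamma>" "(h1 has_contour_integral M1) \<Gamma>"
          "(err has_contour_integral rect_integral err a b) \<Gamma>"
          unfolding M0_def M1_def \<Gamma>_def
          by (intro has_contour_integral_rectpath ch[unfolded \<Gamma>_def] ce[unfolded \<Gamma>_def])+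
        ultimately have "((\<lambda>x. f a / (x - z) + (- (1/y) * h0 x + (- (1/y^2) * h1 x + err x))) has_contour_integral
            0 + (- (1/y) * M0 + (- (1/y^2) * M1 + rect_integral err a b))) \<Gamma>"
          by (intro has_contour_integral_add has_contour_integral_lmul)
        moreover have "f a / (x - z) + (- (1/y) * h0 x + (- (1/y^2) * h1 x + err x)) = f x / (x - z)"
          if "x \<in> path_image \<Gamma>" for x
        proof -
          have xz: "x - z \<noteq> 0" using that zb \<Gamma>(1) by auto
          have yy: "y \<noteq> 0" using Y by auto
          have x: "x - a = (x - z) + y" by (simp add: y_def)
          have "- (1/y) + (- (1/y^2) * (x - a)) + (x - a)^2 / (y^2 * (x - z)) = 1 / (x - z)"
            unfolding x using xz yy by (simp add: power2_eq_square divide_simps) (simp add: algebra_simps)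
          then have "h0 x / (x - z) = h0 x * (- (1/y) + (- (1/y^2) * (x - a)) + (x - a)^2 / (y^2 * (x - z)))"
            by (simp only: times_divide_eq_right mult_1_right)
          also have "\<dots> = - (1/y) * h0 x + (- (1/y^2) * h1 x + err x)"
            unfolding err_def h1_def h0_def[symmetric] by (simp add: distrib_left right_diff_distrib diff_divide_distrib mult_ac)
          finally have hx: "h0 x / (x - z) = \<dots>" .
          have "f a / (x - z) + h0 x / (x - z) = f x / (x - z)"
            by (simp add: h0_def add_divide_distrib[symmetric])
          then show ?thesis unfolding hx .
        qed
        ultimately have "((\<lambda>x. f x / (x - z)) has_contour_integral
            0 + (- (1/y) * M0 + (- (1/y^2) * M1 + rect_integral err a b))) \<Gamma>"
          by (rule has_contour_integral_eq)
        moreover have "continuous_on (path_image \<Gamma>) (\<lambda>x. f x / (x - z))"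
          using zb \<Gamma>(1) by (intro continuous_intros cont) auto
        ultimately have "rect_integral (\<lambda>x. f x / (x - z)) a b = - (1/y) * M0 + (- (1/y^2) * M1 + rect_integral err a b)"
          using rect_integral_eq[of a b "\<lambda>x. f x / (x - z)"] contour_integral_unique unfolding \<Gamma>_def by fastforce
        then have "rect_integral (\<lambda>x. f x / (x - z)) a b + F z
            = M0 * (G1 z - 1 / y) + M1 * (G2 z - 1 / y^2) + rect_integral err a b"
          by (simp add: F_def algebra_simps)
        also have "norm \<dots> \<le> norm M0 * norm (G1 z - 1 / y) + norm M1 * norm (G2 z - 1 / y^2) + norm (rect_integral err a b)"
          by (intro order_trans[OF norm_triangle_ineq] add_mono) (auto simp: norm_mult)
        also have "\<dots> \<le> (4 * d * \<omega>) * (26 * d^2 / Y^3) + (4 * d * (2 * d * \<omega>)) * (13 * d / Y^3) + 20 * (\<omega> * (d / Y)^3)"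
          using M0 M1 G(5,6)[OF z] E \<open>d > 0\<close> \<open>\<omega> \<ge> 0\<close> Y
          by (intro add_mono mult_mono) (auto simp: y_def Y_def)
        also have "\<dots> = 228 * (\<omega> * (d / Y)^3)"
          by (simp add: power_divide power2_eq_square power3_eq_cube field_simps)
        also have "\<dots> \<le> 250 * (\<omega> * (d / Y)^3)"
          using \<open>\<omega> \<ge> 0\<close> \<open>d > 0\<close> Y by (intro mult_right_mono) auto
        finally show ?thesis by (simp add: b_def Y_def)
      qed
    qed
  qed
qed

text \<open>
  By Cauchy's theorem the constant \<open>f a\<close> may be subtracted from \<open>f\<close> before estimating.
\<close>
lemma rect_integral_square_bound:
  assumes "d > 0" "\<omega> \<ge> 0" "continuous_on UNIV f"
    and osc: "\<And>x. x \<in> cbox a (a + Complex d d) \<Longrightarrow> norm (f x - f a) \<le> \<omega>"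
    and far: "\<And>x. x \<in> cbox a (a + Complex d d) \<Longrightarrow> d \<le> norm (x - z)"
  shows "norm (rect_integral (\<lambda>x. f x / (x - z)) a (a + Complex d d)) \<le> 4 * \<omega>"
proof -
  define b where "b = a + Complex d d"
  define \<Gamma> where "\<Gamma> = rectpath a b"
  have \<Gamma>: "path_image \<Gamma> \<subseteq> cbox a b" "valid_path \<Gamma>" "pathfinish \<Gamma> = pathstart \<Gamma>"
    using path_image_rectpath_subset_cbox[of a b] \<open>d > 0\<close> by (auto simp: \<Gamma>_def b_def)
  have z: "z \<notin> cbox a b" using far[of z] \<open>d > 0\<close> by (auto simp: b_def)
  have cont: "continuous_on (path_image \<Gamma>) f" using assms(3) continuous_on_subset by blast
  define h where "h x = (f x - f a) / (x - z)" for x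
  have ch: "continuous_on (path_image \<Gamma>) h" unfolding h_def
    using z \<Gamma>(1) by (intro continuous_intros cont) auto
  have "norm (h x) \<le> \<omega> / d" if "x \<in> cbox a b" for x
    unfolding h_def norm_divide using osc far that assms(1,2) by (intro frac_le) (auto simp: b_def)
  then have "norm (rect_integral h a b) \<le> 4 * d * (\<omega> / d)"
    using rect_integral_bound[of d "\<omega> / d" a h] ch \<Gamma>(1) assms(1,2)
    unfolding b_def \<Gamma>_def by (simp add: subset_iff)
  then have B: "norm (rect_integral h a b) \<le> 4 * \<omega>" using \<open>d > 0\<close> by simp
  have "((\<lambda>x. f a / (x - z)) has_contour_integral 0) \<Gamma>"
  proof (rule Cauchy_theorem_convex_simple[OF _ convex_box(1)])
    show "(\<lambda>x. f a / (x - z)) holomorphic_on cbox a b"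
      using z by (intro holomorphic_intros) auto
  qed (use \<Gamma> in auto)
  moreover have "(h has_contour_integral rect_integral h a b) \<Gamma>"
    using has_contour_integral_rectpath ch unfolding \<Gamma>_def by blast
  ultimately have "((\<lambda>x. f a / (x - z) + h x) has_contour_integral 0 + rect_integral h a b) \<Gamma>"
    by (rule has_contour_integral_add)
  then have "((\<lambda>x. f x / (x - z)) has_contour_integral rect_integral h a b) \<Gamma>"
    by (simp add: h_def diff_divide_distrib)
  moreover have "continuous_on (path_image \<Gamma>) (\<lambda>x. f x / (x - z))"
    using z \<Gamma>(1) by (intro continuous_intros cont) auto
  ultimately have "rect_integral (\<lambda>x. f x / (x - z)) a b = rect_integral h a b"
    using rect_integral_eq[of a b] contour_integral_unique unfolding \<Gamma>_def by metis
  then show ?thesis using B by (simp add: b_def)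
qed

definition grid_point :: "complex \<Rightarrow> real \<Rightarrow> nat \<Rightarrow> nat \<Rightarrow> complex" where
  "grid_point c d i j = c + Complex (d * real i) (d * real j)"

lemma grid_point_simps [simp]:
  "Re (grid_point c d i j) = Re c + d * real i" "Im (grid_point c d i j) = Im c + d * real j"
  by (simp_all add: grid_point_def)

lemma grid_point_Suc: "grid_point c d (Suc i) (Suc j) = grid_point c d i j + Complex d d"
  by (simp add: complex_eq_iff algebra_simps)

lemma Complex_grid_point:
  "Complex (Re (grid_point c d i j)) (Im (grid_point c d i' j')) = grid_point c d i j'"
  by (simp add: complex_eq_iff)

lemma sum_horizontal_edges:
  assumes "d \<ge> 0" "i0 \<le> i1" "continuous_on (closed_segment (grid_point c d i0 j) (grid_point c d i1 j)) u"
  shows "(\<Sum>i=i0..<i1. contour_integral (linepath (grid_point c d i j) (grid_point c d (Suc i) j)) u)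
         = contour_integral (linepath (grid_point c d i0 j) (grid_point c d i1 j)) u"
  using assms(2,3)
proof (induction i1 rule: dec_induct)
  case base
  then show ?case unfolding contour_integral_trivial by simp
next
  case (step k)
  have k: "grid_point c d k j \<in> closed_segment (grid_point c d i0 j) (grid_point c d (Suc k) j)"
    using step(1) assms(1) by (auto simp: closed_segment_same_Im closed_segment_eq_real_ivl mult_left_mono)
  then have "closed_segment (grid_point c d i0 j) (grid_point c d k j)
      \<subseteq> closed_segment (grid_point c d i0 j) (grid_point c d (Suc k) j)"
    by (simp add: subset_closed_segment)
  then show ?case
    using step contour_integral_split_linepath[OF step.prems k] continuous_on_subset[OF step.prems] by simp
qed

lemma sum_vertical_edges:
  assumes "d \<ge> 0" "j0 \<le> j1" "continuous_on (closed_segment (grid_point c d i j0) (grid_point c d i j1)) u"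
  shows "(\<Sum>j=j0..<j1. contour_integral (linepath (grid_point c d i j) (grid_point c d i (Suc j))) u)
         = contour_integral (linepath (grid_point c d i j0) (grid_point c d i j1)) u"
  using assms(2,3)
proof (induction j1 rule: dec_induct)
  case base
  then show ?case unfolding contour_integral_trivial by simp
next
  case (step k)
  have k: "grid_point c d i k \<in> closed_segment (grid_point c d i j0) (grid_point c d i (Suc k))"
    using step(1) assms(1) by (auto simp: closed_segment_same_Re closed_segment_eq_real_ivl mult_left_mono)
  then have "closed_segment (grid_point c d i j0) (grid_point c d i k)
      \<subseteq> closed_segment (grid_point c d i j0) (grid_point c d i (Suc k))"
    by (simp add: subset_closed_segment)
  then show ?case
    using step contour_integral_split_linepath[OF step.prems k] continuous_on_subset[OF step.prems] by simp
qed

text \<open>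
  Inner edges telescope away; continuity matters only on the outer boundary, where the edges are joined.
\<close>
lemma sum_rect_integral_grid:
  assumes "d \<ge> 0" "i0 \<le> i1" "j0 \<le> j1"
    and cont: "continuous_on (path_image (rectpath (grid_point c d i0 j0) (grid_point c d i1 j1))) u"
  shows "(\<Sum>i=i0..<i1. \<Sum>j=j0..<j1. rect_integral u (grid_point c d i j) (grid_point c d (Suc i) (Suc j)))
         = rect_integral u (grid_point c d i0 j0) (grid_point c d i1 j1)"
proof -
  define H where "H i j = contour_integral (linepath (grid_point c d i j) (grid_point c d (Suc i) j)) u" for i j
  define V where "V i j = contour_integral (linepath (grid_point c d i j) (grid_point c d i (Suc j))) u" for i j
  have sq: "rect_integral u (grid_point c d i j) (grid_point c d (Suc i) (Suc j))
      = (V (Suc i) j - V i j) - (H i (Suc j) - H i j)" for i j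
    unfolding rect_integral_def Complex_grid_point H_def V_def by simp
  have "(\<Sum>i=i0..<i1. \<Sum>j=j0..<j1. rect_integral u (grid_point c d i j) (grid_point c d (Suc i) (Suc j)))
      = (\<Sum>j=j0..<j1. \<Sum>i=i0..<i1. V (Suc i) j - V i j) - (\<Sum>i=i0..<i1. \<Sum>j=j0..<j1. H i (Suc j) - H i j)"
    unfolding sq sum_subtractf[of "\<lambda>j. V _ j - V _ j"] sum_subtractf by (simp add: sum.swap[of _ "{i0..<i1}" "{j0..<j1}"])
  also have "\<dots> = (\<Sum>j=j0..<j1. V i1 j - V i0 j) - (\<Sum>i=i0..<i1. H i j1 - H i j0)"
    using assms by (simp add: sum_Suc_diff' sum_Suc_diff'[of i0 i1 "\<lambda>i. V i j" for j])
  also have "\<dots> = rect_integral u (grid_point c d i0 j0) (grid_point c d i1 j1)"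
  proof -
    have "continuous_on (closed_segment (grid_point c d i0 j0) (grid_point c d i1 j0)) u"
      "continuous_on (closed_segment (grid_point c d i0 j1) (grid_point c d i1 j1)) u"
      "continuous_on (closed_segment (grid_point c d i0 j0) (grid_point c d i0 j1)) u"
      "continuous_on (closed_segment (grid_point c d i1 j0) (grid_point c d i1 j1)) u"
      using cont unfolding rectpath_edges Complex_grid_point by (auto intro: continuous_on_subset)
    then show ?thesis
      unfolding rect_integral_def Complex_grid_point sum_subtractf H_def V_def
      using assms by (simp add: sum_horizontal_edges sum_vertical_edges)
  qed
  finally show ?thesis .
qed

section \<open>Mergelyan's theorem\<close>

text \<open>
  Errors decay like the inverse cube of the larger of two coordinate distances. Splitting the exponent as \<open>3/2 + 3/2\<close>
  bounds them by products of one-dimensional weights, so that the double sum factors into convergent sums.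
\<close>
definition index_weight :: "nat \<Rightarrow> real" where
  "index_weight n = real (Suc n) powr (-3/2)"

lemma index_weight_pos: "index_weight n > 0"
  by (simp add: index_weight_def)

lemma summable_index_weight: "summable index_weight"
proof -
  have "summable (\<lambda>n. real n powr (-3/2))" by (simp add: summable_real_powr_iff)
  then have "summable (\<lambda>n. real (Suc n) powr (-3/2))" by (subst summable_Suc_iff)
  then show ?thesis by (simp add: index_weight_def[abs_def])
qed

lemma index_weight_mult:
  assumes "m \<le> k" "n \<le> k"
  shows "1 / real (Suc k) ^ 3 \<le> index_weight m * index_weight n"
proof -
  have w: "real (Suc k) powr (-3/2) \<le> index_weight l" if "l \<le> k" for l
    using that unfolding index_weight_def by (intro powr_mono2') auto
  have "1 / real (Suc k) ^ 3 = real (Suc k) powr (-3)"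
    by (simp add: powr_minus_divide)
  also have "\<dots> = real (Suc k) powr (-3/2) * real (Suc k) powr (-3/2)"
    by (simp add: powr_add[symmetric])
  also have "\<dots> \<le> index_weight m * index_weight n"
    using w assms index_weight_pos by (intro mult_mono) (auto intro: less_imp_le)
  finally show ?thesis .
qed

text \<open>
  The absolute difference: one of the two truncated subtractions is 0.
\<close>
definition index_dist :: "nat \<Rightarrow> nat \<Rightarrow> nat" where
  "index_dist i j = (i - j) + (j - i)"

lemma sum_index_weight:
  "(\<Sum>i<N. index_weight (index_dist i i0)) \<le> 2 * suminf index_weight"
proof -
  have part: "(\<Sum>i\<in>I. index_weight (index_dist i i0)) \<le> suminf index_weight"
    if "finite I" "inj_on (\<lambda>i. index_dist i i0) I" for I
  proof -
    have "(\<Sum>i\<in>I. index_weight (index_dist i i0)) = sum index_weight ((\<lambda>i. index_dist i i0) ` I)"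
      by (simp add: sum.reindex[OF that(2)])
    also have "\<dots> \<le> suminf index_weight"
      using that(1) by (intro sum_le_suminf summable_index_weight) (auto intro: less_imp_le index_weight_pos)
    finally show ?thesis .
  qed
  have "(\<Sum>i<N. index_weight (index_dist i i0))
      = (\<Sum>i\<in>{i. i < N \<and> i \<le> i0}. index_weight (index_dist i i0)) + (\<Sum>i\<in>{i. i < N \<and> i0 < i}. index_weight (index_dist i i0))"
    by (subst sum.union_disjoint[symmetric]) (auto intro!: sum.cong)
  also have "\<dots> \<le> suminf index_weight + suminf index_weight"
    by (intro add_mono part) (auto simp: inj_on_def index_dist_def)
  finally show ?thesis by simp
qed

lemma continuous_vanishing_outside_ball_uniform:
  fixes f :: "complex \<Rightarrow> complex"
  assumes "continuous_on UNIV f" "\<And>x. norm x \<ge> R \<Longrightarrow> f x = 0" "e > 0"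
  obtains \<delta> where "\<delta> > 0" "\<And>x y. dist x y < \<delta> \<Longrightarrow> norm (f x - f y) \<le> e"
proof -
  have "uniformly_continuous_on (cball 0 (R + 1)) f"
    using assms(1) by (intro compact_uniformly_continuous) (auto intro: continuous_on_subset)
  then obtain \<delta> where \<delta>: "\<delta> > 0"
    "\<And>x y. x \<in> cball 0 (R+1) \<Longrightarrow> y \<in> cball 0 (R+1) \<Longrightarrow> dist y x < \<delta> \<Longrightarrow> dist (f y) (f x) < e"
    using assms(3) unfolding uniformly_continuous_on_def by metis
  have "norm (f x - f y) \<le> e" if xy: "dist x y < min \<delta> 1" for x y
  proof (cases "norm x \<ge> R \<and> norm y \<ge> R")
    case True
    then show ?thesis using assms by simp
  next
    case False
    then have "x \<in> cball 0 (R+1)" "y \<in> cball 0 (R+1)"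
      using xy norm_triangle_ineq2[of x y] norm_triangle_ineq2[of y x] by (auto simp: dist_norm norm_minus_commute)
    then show ?thesis using \<delta>(2)[of y x] xy by (simp add: dist_norm)
  qed
  then show thesis using that[of "min \<delta> 1"] \<delta> by simp
qed

text \<open>
  Cauchy's formula for the constant \<open>f z\<close>; the rest of \<open>f\<close> is at most \<open>\<omega>\<close>.
\<close>
lemma rect_integral_around:
  assumes "d > 0" "\<omega> \<ge> 0" "D > 0" "continuous_on UNIV f"
    and osc: "\<And>x. x \<in> cbox a (a + Complex D D) \<Longrightarrow> norm (f x - f z) \<le> \<omega>"
    and far: "\<And>x. x \<in> path_image (rectpath a (a + Complex D D)) \<Longrightarrow> d \<le> norm (x - z)"
    and z: "z \<in> box a (a + Complex D D)"
  shows "norm (rect_integral (\<lambda>x. f x / (x - z)) a (a + Complex D D) - 2 * pi * \<i> * f z) \<le> 4 * D * (\<omega> / d)"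
proof -
  define b where "b = a + Complex D D"
  define \<Gamma> where "\<Gamma> = rectpath a b"
  have \<Gamma>: "path_image \<Gamma> \<subseteq> cbox a b"
    using path_image_rectpath_subset_cbox[of a b] \<open>D > 0\<close> by (auto simp: \<Gamma>_def b_def)
  have zn: "z \<notin> path_image \<Gamma>" using far[of z] \<open>d > 0\<close> by (auto simp: b_def \<Gamma>_def)
  have cont: "continuous_on (path_image \<Gamma>) f" using assms(4) continuous_on_subset by blast
  define h where "h x = (f x - f z) / (x - z)" for x
  have ch: "continuous_on (path_image \<Gamma>) h" unfolding h_def
    using zn by (intro continuous_intros cont) auto
  have "norm (h x) \<le> \<omega> / d" if "x \<in> path_image \<Gamma>" for x
    unfolding h_def norm_divide using osc far that \<Gamma> assms(1,2) by (intro frac_le) (auto simp: b_def \<Gamma>_def)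
  then have B: "norm (rect_integral h a b) \<le> 4 * D * (\<omega> / d)"
    using rect_integral_bound[of D "\<omega> / d" a h] ch assms(1-3)
    unfolding b_def \<Gamma>_def by simp
  have c1: "continuous_on (path_image \<Gamma>) (\<lambda>x. 1 / (x - z))"
    using zn by (intro continuous_intros) auto
  have "winding_number \<Gamma> z = 1"
    unfolding \<Gamma>_def b_def by (rule winding_number_rectpath[OF z])
  then have "contour_integral \<Gamma> (\<lambda>x. 1 / (x - z)) = 2 * pi * \<i>"
    using winding_number_valid_path[of \<Gamma> z] zn by (simp add: \<Gamma>_def field_simps)
  then have "((\<lambda>x. 1 / (x - z)) has_contour_integral 2 * pi * \<i>) \<Gamma>"
    using has_contour_integral_rectpath[of a b "\<lambda>x. 1 / (x - z)"] rect_integral_eq[of a b "\<lambda>x. 1 / (x - z)"] c1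
    unfolding \<Gamma>_def by simp
  then have "((\<lambda>x. f z * (1 / (x - z)) + h x) has_contour_integral f z * (2 * pi * \<i>) + rect_integral h a b) \<Gamma>"
    using has_contour_integral_rectpath[of a b h] ch unfolding \<Gamma>_def
    by (intro has_contour_integral_add has_contour_integral_lmul) auto
  then have "((\<lambda>x. f x / (x - z)) has_contour_integral f z * (2 * pi * \<i>) + rect_integral h a b) \<Gamma>"
    by (simp add: h_def diff_divide_distrib)
  moreover have "continuous_on (path_image \<Gamma>) (\<lambda>x. f x / (x - z))"
    using zn by (intro continuous_intros cont) auto
  ultimately have "rect_integral (\<lambda>x. f x / (x - z)) a b = f z * (2 * pi * \<i>) + rect_integral h a b"
    using rect_integral_eq[of a b] contour_integral_unique unfolding \<Gamma>_def by metis
  then show ?thesis using B by (simp add: b_def mult.commute)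
qed

text \<open>
  The grid argument. The constant is independent of \<open>\<omega>\<close>, \<open>f\<close> and \<open>K\<close>, which is what allows \<open>\<omega>\<close> to tend to 0.
\<close>
lemma Mergelyan_estimate:
  assumes K: "compact K" "connected (- K)" and f: "continuous_on UNIV f" "f holomorphic_on interior K"
    and R: "\<And>x. norm x \<ge> R \<Longrightarrow> f x = 0" "K \<subseteq> ball 0 R"
    and "\<omega> > 0"
  obtains F where "poly_approx K F"
    "\<And>z. z \<in> K \<Longrightarrow> norm (2 * pi * \<i> * f z - F z) \<le> (12 + 10^9 * (2 * suminf index_weight)^2) * \<omega>"
proof (cases "K = {}")
  case True
  then show thesis using that[of "\<lambda>z. 0"] poly_approx_const by auto
next
  case False
  then have "R > 0" using R(2) by (metis all_not_in_conv ball_eq_empty linorder_not_less subset_empty)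
  obtain \<delta> where \<delta>: "\<delta> > 0" "\<And>x y. dist x y < \<delta> \<Longrightarrow> norm (f x - f y) \<le> \<omega>"
    using continuous_vanishing_outside_ball_uniform[OF f(1) R(1) \<open>\<omega> > 0\<close>] by blast
  \<comment> \<open>All points of a 3 by 3 block are within \<open>4 * d\<close> of the points of its central square.\<close>
  define d where "d = \<delta> / 5"
  have d: "d > 0" "5 * d = \<delta>" using \<delta> by (auto simp: d_def)
  have osc: "norm (f x - f y) \<le> \<omega>" if "norm (x - y) \<le> 4 * d" for x y
    using \<delta>(2)[of x y] that d by (simp add: dist_norm)
  \<comment> \<open>The margin \<open>2 * d\<close> around the support keeps the 3 by 3 block of every point of \<open>K\<close> inside the grid.\<close>
  define L where "L = R + 2 * d"
  define N where "N = nat \<lceil>2 * L / d\<rceil>"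
  define pt where "pt = grid_point (Complex (- L) (- L)) d"
  have pt [simp]: "Re (pt i j) = - L + d * real i" "Im (pt i j) = - L + d * real j" for i j
    by (simp_all add: pt_def)
  have pt_Suc: "pt (Suc i) (Suc j) = pt i j + Complex d d" for i j
    by (simp add: pt_def grid_point_Suc)
  have "L > 0" using d \<open>R > 0\<close> by (simp add: L_def)
  have N: "2 * L \<le> d * real N"
  proof -
    have "2 * L / d \<le> real N" unfolding N_def by (simp add: real_nat_ceiling_ge)
    then show ?thesis using d by (simp add: divide_le_eq mult.commute)
  qed
  define Q where "Q i j F \<longleftrightarrow> poly_approx K F \<and> (\<forall>z\<in>K. norm (F z) \<le> 600000 * \<omega>) \<and>
      (\<forall>z\<in>K. 10 * d \<le> dist z (pt i j) \<longrightarrow>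
       norm (rect_integral (\<lambda>x. f x / (x - z)) (pt i j) (pt (Suc i) (Suc j)) + F z) \<le> 250 * \<omega> * (d / dist z (pt i j)) ^ 3)"
    for i j F
  have "\<exists>F. Q i j F" for i j
  proof -
    have "norm (f x - f (pt i j)) \<le> \<omega>" if "x \<in> cbox (pt i j) (pt i j + Complex d d)" for x
      using norm_diff_corner_le[OF that] d by (intro osc) auto
    then show ?thesis
      unfolding Q_def pt_Suc
      by (rule square_approx[OF K d(1) less_imp_le[OF \<open>\<omega> > 0\<close>] f, of "pt i j"]) blast+
  qed
  then obtain F where Q: "\<And>i j. Q i j (F i j)" by metis
  then have F: "\<And>i j. poly_approx K (F i j)" "\<And>i j z. z \<in> K \<Longrightarrow> norm (F i j z) \<le> 600000 * \<omega>"
    "\<And>i j z. z \<in> K \<Longrightarrow> 10 * d \<le> dist z (pt i j) \<Longrightarrow>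
       norm (rect_integral (\<lambda>x. f x / (x - z)) (pt i j) (pt (Suc i) (Suc j)) + F i j z) \<le> 250 * \<omega> * (d / dist z (pt i j)) ^ 3"
    unfolding Q_def by blast+
  define A where "A = suminf index_weight"
  show thesis
  proof (rule that[of "\<lambda>z. \<Sum>i<N. \<Sum>j<N. F i j z"])
    show "poly_approx K (\<lambda>z. \<Sum>i<N. \<Sum>j<N. F i j z)"
      by (intro poly_approx_sum F)
    fix z assume z: "z \<in> K"
    define u where "u x = f x / (x - z)" for x
    define S where "S i j = rect_integral u (pt i j) (pt (Suc i) (Suc j))" for i j
    have nz: "\<bar>Re z\<bar> < R" "\<bar>Im z\<bar> < R"
      using z R(2) abs_Re_le_cmod[of z] abs_Im_le_cmod[of z] by (auto simp: subset_iff intro: le_less_trans)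
    have idx: "\<exists>i. d * real i \<le> t + L \<and> t + L < d * (real i + 1) \<and> 1 \<le> i \<and> i + 2 \<le> N" if "\<bar>t\<bar> < R" for t
    proof -
      define i where "i = nat \<lfloor>(t + L) / d\<rfloor>"
      have t2: "2 * d \<le> t + L" "t + L < 2 * L - 2 * d" using that by (auto simp: L_def)
      then have "0 \<le> (t + L) / d" using d by simp
      then have i: "real i \<le> (t + L) / d" "(t + L) / d < real i + 1"
        unfolding i_def by (simp_all add: of_nat_floor)
      then have i': "d * real i \<le> t + L" "t + L < d * (real i + 1)"
        using d by (simp_all add: pos_le_divide_eq pos_divide_less_eq mult.commute)
      have "d * 2 < d * (real i + 1)" using i' t2 by linarith
      then have "1 \<le> i" using d by simp
      have "d * (real i + 2) < d * real N" using i' t2 N by (simp add: distrib_left)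
      then have "real i + 2 < real N" using d by simp
      then have "i + 2 \<le> N" by linarith
      then show ?thesis using i' \<open>1 \<le> i\<close> by blast
    qed
    obtain i0 where i0: "d * real i0 \<le> Re z + L" "Re z + L < d * (real i0 + 1)" "1 \<le> i0" "i0 + 2 \<le> N"
      using idx[OF nz(1)] by blast
    obtain j0 where j0: "d * real j0 \<le> Im z + L" "Im z + L < d * (real j0 + 1)" "1 \<le> j0" "j0 + 2 \<le> N"
      using idx[OF nz(2)] by blast
    define B where "B = {i0 - 1..<i0 + 2} \<times> {j0 - 1..<j0 + 2}"
    have B: "B \<subseteq> {..<N} \<times> {..<N}" "finite B" using i0 j0 by (auto simp: B_def)
    \<comment> \<open>The boundary of the whole grid lies outside the support of \<open>f\<close>.\<close>
    have total: "(\<Sum>(i,j)\<in>{..<N} \<times> {..<N}. S i j) = 0"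
    proof -
      have out: "f x = 0 \<and> x \<noteq> z" if "x \<in> path_image (rectpath (pt 0 0) (pt N N))" for x
      proof -
        have "Re x = - L \<or> Re x = - L + d * N \<or> Im x = - L \<or> Im x = - L + d * N"
          using that d by (subst (asm) path_image_rectpath) auto
        then have "L \<le> \<bar>Re x\<bar> \<or> L \<le> \<bar>Im x\<bar>" using N \<open>L > 0\<close> by auto
        then have "L \<le> norm x" using abs_Re_le_cmod[of x] abs_Im_le_cmod[of x] by linarith
        then have "R < norm x" using d by (simp add: L_def)
        moreover have "norm z < R" using z R(2) by auto
        ultimately show ?thesis using R(1)[of x] by auto
      qed
      then have u0: "u x = 0" if "x \<in> path_image (rectpath (pt 0 0) (pt N N))" for x
        using that by (simp add: u_def)
      then have c: "continuous_on (path_image (rectpath (pt 0 0) (pt N N))) u"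
        by (simp cong: continuous_on_cong)
      have "(\<Sum>(i,j)\<in>{..<N} \<times> {..<N}. S i j) = (\<Sum>i=0..<N. \<Sum>j=0..<N. S i j)"
        by (simp add: sum.cartesian_product atLeast0LessThan)
      also have "\<dots> = rect_integral u (pt 0 0) (pt N N)"
        using c d unfolding S_def pt_def by (intro sum_rect_integral_grid) auto
      also have "\<dots> = 0"
        using rect_integral_eq[OF c] contour_integral_eq_0[of "rectpath (pt 0 0) (pt N N)" u] u0 by simp
      finally show ?thesis .
    qed
    \<comment> \<open>The distance from \<open>z\<close> to the boundary of the 3 by 3 block around its square is at least \<open>d\<close>.\<close>
    have block: "norm ((\<Sum>(i,j)\<in>B. S i j) - 2 * pi * \<i> * f z) \<le> 12 * \<omega>"
    proof -
      define a where "a = pt (i0 - 1) (j0 - 1)"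
      have a: "Re a = - L + d * real i0 - d" "Im a = - L + d * real j0 - d"
        using i0 j0 by (auto simp: a_def of_nat_diff algebra_simps)
      have b: "pt (i0 + 2) (j0 + 2) = a + Complex (3 * d) (3 * d)"
        by (simp add: complex_eq_iff a algebra_simps)
      have far: "d \<le> norm (x - z)" if "x \<in> path_image (rectpath a (a + Complex (3 * d) (3 * d)))" for x
      proof -
        have "Re x = Re a \<or> Re x = Re a + 3 * d \<or> Im x = Im a \<or> Im x = Im a + 3 * d"
          using that d by (subst (asm) path_image_rectpath) auto
        then have "d \<le> \<bar>Re x - Re z\<bar> \<or> d \<le> \<bar>Im x - Im z\<bar>"
          using i0 j0 by (auto simp: a algebra_simps)
        then show ?thesis using abs_Re_le_cmod[of "x - z"] abs_Im_le_cmod[of "x - z"] by auto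
      qed
      have zbox: "z \<in> box a (a + Complex (3 * d) (3 * d))"
        using i0 j0 d by (auto simp: in_box_complex_iff a algebra_simps)
      have osc': "norm (f x - f z) \<le> \<omega>" if "x \<in> cbox a (a + Complex (3 * d) (3 * d))" for x
      proof (rule osc)
        have "\<bar>Re (x - z)\<bar> \<le> 2 * d" "\<bar>Im (x - z)\<bar> \<le> 2 * d"
          using that i0 j0 by (auto simp: in_cbox_complex_iff a algebra_simps)
        then show "norm (x - z) \<le> 4 * d" using cmod_le[of "x - z"] by linarith
      qed
      have c: "continuous_on (path_image (rectpath (pt (i0 - 1) (j0 - 1)) (pt (i0 + 2) (j0 + 2)))) u"
      proof -
        have "x \<noteq> z" if "x \<in> path_image (rectpath (pt (i0 - 1) (j0 - 1)) (pt (i0 + 2) (j0 + 2)))" for x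
          using far[of x] that d unfolding b a_def[symmetric] by auto
        then show ?thesis unfolding u_def
          by (intro continuous_intros continuous_on_subset[OF f(1)]) auto
      qed
      have "(\<Sum>(i,j)\<in>B. S i j) = (\<Sum>i=i0 - 1..<i0 + 2. \<Sum>j=j0 - 1..<j0 + 2. S i j)"
        by (simp only: sum.cartesian_product B_def)
      also have "\<dots> = rect_integral u (pt (i0 - 1) (j0 - 1)) (pt (i0 + 2) (j0 + 2))"
        unfolding S_def pt_def
        by (rule sum_rect_integral_grid[OF less_imp_le[OF d(1)] _ _ c[unfolded pt_def]]) simp_all
      finally have "(\<Sum>(i,j)\<in>B. S i j) = rect_integral u a (a + Complex (3 * d) (3 * d))"
        unfolding b a_def .
      moreover have "norm (rect_integral u a (a + Complex (3 * d) (3 * d)) - 2 * pi * \<i> * f z) \<le> 4 * (3 * d) * (\<omega> / d)"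
        unfolding u_def using d \<open>\<omega> > 0\<close> by (intro rect_integral_around f(1) osc' far zbox) auto
      ultimately show ?thesis using d by simp
    qed
    \<comment> \<open>Squares of the block contribute only their replacement \<open>F i j\<close>, the others the difference between integral and replacement.\<close>
    define E where "E i j = (if (i,j) \<in> B then F i j z else S i j + F i j z)" for i j
    have E: "norm (E i j) \<le> 10^9 * \<omega> * (index_weight (index_dist i i0) * index_weight (index_dist j j0))" for i j
    proof -
      define k where "k = max (index_dist i i0) (index_dist j j0)"
      have W: "1 / real (Suc k) ^ 3 \<le> index_weight (index_dist i i0) * index_weight (index_dist j j0)"
        by (rule index_weight_mult) (auto simp: k_def)
      have dist: "(real k - 1) * d \<le> norm (x - z)" if x: "x \<in> cbox (pt i j) (pt i j + Complex d d)" for x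
      proof -
        have coord: "(real (index_dist m n) - 1) * d \<le> \<bar>s - t\<bar>"
          if "d * real m \<le> s" "s \<le> d * real m + d" "d * real n \<le> t" "t < d * (real n + 1)" for m n s t
          using that by (cases "m \<ge> n") (auto simp: index_dist_def of_nat_diff algebra_simps)
        have "(real (index_dist i i0) - 1) * d \<le> \<bar>(Re x + L) - (Re z + L)\<bar>"
          using x i0 by (intro coord) (auto simp: in_cbox_complex_iff)
        moreover have "(real (index_dist j j0) - 1) * d \<le> \<bar>(Im x + L) - (Im z + L)\<bar>"
          using x j0 by (intro coord) (auto simp: in_cbox_complex_iff)
        ultimately have "(real k - 1) * d \<le> max \<bar>Re (x - z)\<bar> \<bar>Im (x - z)\<bar>"
          by (auto simp: k_def max_def)
        also have "\<dots> \<le> norm (x - z)" using abs_Re_le_cmod[of "x - z"] abs_Im_le_cmod[of "x - z"] by (rule max.boundedI)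
        finally show ?thesis .
      qed
      have "pt i j \<in> cbox (pt i j) (pt i j + Complex d d)" using d(1) by (simp add: in_cbox_complex_iff)
      from dist[OF this] have dist': "(real k - 1) * d \<le> dist z (pt i j)"
        by (simp only: dist_norm norm_minus_commute[of z])
      \<comment> \<open>Squares fewer than 11 steps away are too close for the expansion at infinity; there are boundedly many,
        and the large constant absorbs the factor \<open>11^3\<close>.\<close>
      have "norm (E i j) \<le> 10^9 * \<omega> * (1 / real (Suc k) ^ 3)"
      proof (cases "k \<le> 10")
        case True
        have "norm (E i j) \<le> 600004 * \<omega>"
        proof (cases "(i,j) \<in> B")
          case True
          then show ?thesis using F(2)[OF z, of i j] \<open>\<omega> > 0\<close> by (simp add: E_def)
        next
          case False
          then have "k \<ge> 2"
            using i0 j0 by (auto simp: B_def k_def index_dist_def)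
          have "norm (S i j) \<le> 4 * \<omega>"
            unfolding S_def u_def pt_Suc
          proof (rule rect_integral_square_bound[OF d(1) _ f(1)])
            show "norm (f x - f (pt i j)) \<le> \<omega>" if "x \<in> cbox (pt i j) (pt i j + Complex d d)" for x
              using norm_diff_corner_le[OF that] d by (intro osc) auto
            show "d \<le> norm (x - z)" if "x \<in> cbox (pt i j) (pt i j + Complex d d)" for x
            proof -
              have "1 * d \<le> (real k - 1) * d" using \<open>k \<ge> 2\<close> d by (intro mult_right_mono) auto
              then show ?thesis using dist[OF that] by simp
            qed
          qed (use \<open>\<omega> > 0\<close> in auto)
          then show ?thesis using F(2)[OF z, of i j] norm_triangle_ineq[of "S i j" "F i j z"] False
            by (simp add: E_def)
        qed
        also have "\<dots> \<le> 10^9 * \<omega> * (1 / 11^3)" using \<open>\<omega> > 0\<close> by simp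
        also have "\<dots> \<le> 10^9 * \<omega> * (1 / real (Suc k) ^ 3)"
          using True \<open>\<omega> > 0\<close> by (intro mult_left_mono divide_left_mono power_mono) auto
        finally show ?thesis .
      next
        case False
        then have "(i,j) \<notin> B" by (auto simp: B_def k_def index_dist_def)
        have k: "1/2 * real (Suc k) \<le> real k - 1" using False by simp
        have "10 * d \<le> (real k - 1) * d" using False d by (intro mult_right_mono) auto
        then have far: "10 * d \<le> dist z (pt i j)" using dist' by simp
        have "(1/2 * real (Suc k)) * d \<le> (real k - 1) * d" using k d by (intro mult_right_mono) auto
        then have far': "(1/2 * real (Suc k)) * d \<le> dist z (pt i j)" using dist' by simp
        have "norm (E i j) \<le> 250 * \<omega> * (d / dist z (pt i j)) ^ 3"
          using F(3)[OF z far] \<open>(i,j) \<notin> B\<close> by (simp add: E_def S_def u_def[abs_def])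
        also have "\<dots> \<le> 250 * \<omega> * (d / ((1/2 * real (Suc k)) * d)) ^ 3"
        proof (intro mult_left_mono power_mono)
          show "d / dist z (pt i j) \<le> d / ((1/2 * real (Suc k)) * d)"
            by (rule frac_le[OF _ order_refl _ far']) (use d(1) in simp_all)
        qed (use d(1) \<open>\<omega> > 0\<close> in simp_all)
        also have "\<dots> = 2000 * \<omega> * (1 / real (Suc k) ^ 3)"
          using d(1) by (simp add: power_divide)
        also have "\<dots> \<le> 10^9 * \<omega> * (1 / real (Suc k) ^ 3)"
          using \<open>\<omega> > 0\<close> by (intro mult_right_mono) auto
        finally show ?thesis .
      qed
      also have "\<dots> \<le> 10^9 * \<omega> * (index_weight (index_dist i i0) * index_weight (index_dist j j0))"
        using W \<open>\<omega> > 0\<close> by (intro mult_left_mono) auto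
      finally show ?thesis .
    qed
    have sumE: "(\<Sum>(i,j)\<in>{..<N} \<times> {..<N}. E i j) = (\<Sum>i<N. \<Sum>j<N. F i j z) - (\<Sum>(i,j)\<in>B. S i j)"
    proof -
      have "(\<Sum>(i,j)\<in>{..<N} \<times> {..<N}. E i j) = (\<Sum>(i,j)\<in>{..<N} \<times> {..<N}. F i j z + S i j - (if (i,j) \<in> B then S i j else 0))"
        by (intro sum.cong) (auto simp: E_def)
      also have "\<dots> = (\<Sum>(i,j)\<in>{..<N} \<times> {..<N}. F i j z) + (\<Sum>(i,j)\<in>{..<N} \<times> {..<N}. S i j)
          - (\<Sum>(i,j)\<in>{..<N} \<times> {..<N}. if (i,j) \<in> B then S i j else 0)"
        by (simp add: case_prod_unfold sum.distrib sum_subtractf)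
      also have "(\<Sum>(i,j)\<in>{..<N} \<times> {..<N}. if (i,j) \<in> B then S i j else 0) = (\<Sum>(i,j)\<in>B. S i j)"
        using B by (intro sum.mono_neutral_cong_right) auto
      finally show ?thesis by (simp add: total sum.cartesian_product)
    qed
    have "norm (\<Sum>(i,j)\<in>{..<N} \<times> {..<N}. E i j)
        \<le> (\<Sum>(i,j)\<in>{..<N} \<times> {..<N}. 10^9 * \<omega> * (index_weight (index_dist i i0) * index_weight (index_dist j j0)))"
      using E by (intro sum_norm_le) auto
    also have "\<dots> = 10^9 * \<omega> * ((\<Sum>i<N. index_weight (index_dist i i0)) * (\<Sum>j<N. index_weight (index_dist j j0)))"
      by (subst sum_product) (simp only: sum_distrib_left sum.cartesian_product case_prod_unfold)
    also have "\<dots> \<le> 10^9 * \<omega> * ((2 * A) * (2 * A))"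
    proof (rule mult_left_mono)
      have W: "(\<Sum>i<N. index_weight (index_dist i l)) \<le> 2 * A" for l
        unfolding A_def by (rule sum_index_weight)
      have W0: "0 \<le> (\<Sum>i<N. index_weight (index_dist i l))" for l
        by (intro sum_nonneg less_imp_le index_weight_pos)
      show "(\<Sum>i<N. index_weight (index_dist i i0)) * (\<Sum>j<N. index_weight (index_dist j j0)) \<le> (2 * A) * (2 * A)"
        by (rule mult_mono[OF W W order_trans[OF W0 W] W0])
    qed (use \<open>\<omega> > 0\<close> in simp)
    finally have "norm ((\<Sum>i<N. \<Sum>j<N. F i j z) - (\<Sum>(i,j)\<in>B. S i j)) \<le> 10^9 * \<omega> * ((2 * A) * (2 * A))"
      unfolding sumE .
    moreover have "norm (2 * pi * \<i> * f z - (\<Sum>i<N. \<Sum>j<N. F i j z))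
        \<le> norm ((\<Sum>i<N. \<Sum>j<N. F i j z) - (\<Sum>(i,j)\<in>B. S i j)) + norm ((\<Sum>(i,j)\<in>B. S i j) - 2 * pi * \<i> * f z)"
      using dist_triangle[of "\<Sum>i<N. \<Sum>j<N. F i j z" "2 * pi * \<i> * f z" "\<Sum>(i,j)\<in>B. S i j"]
      unfolding dist_norm by (subst norm_minus_commute)
    ultimately have "norm (2 * pi * \<i> * f z - (\<Sum>i<N. \<Sum>j<N. F i j z)) \<le> 10^9 * \<omega> * ((2 * A) * (2 * A)) + 12 * \<omega>"
      using block by linarith
    then show "norm (2 * pi * \<i> * f z - (\<Sum>i<N. \<Sum>j<N. F i j z)) \<le> (12 + 10^9 * (2 * suminf index_weight)^2) * \<omega>"
      by (simp add: A_def power2_eq_square algebra_simps)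
  qed
qed

text \<open>
  Dugundji's theorem and a cutoff extend \<open>h\<close> to a continuous function with compact support on the plane, to which
  \<open>Mergelyan_estimate\<close> applies.
\<close>
theorem Mergelyan:
  assumes K: "compact K" "connected (- K)" and h: "continuous_on K h" "h holomorphic_on interior K"
  shows "poly_approx K h"
proof (cases "K = {}")
  case True
  then show ?thesis by (simp add: poly_approx_def)
next
  case False
  obtain g :: "complex \<Rightarrow> complex" where g: "continuous_on UNIV g" "\<And>x. x \<in> K \<Longrightarrow> g x = h x"
    using Dugundji[of UNIV UNIV K h] K(1) h(1) by (auto intro: compact_imp_closed)
  define f where "f x = of_real (max 0 (1 - infdist x K)) * g x" for x
  have f: "continuous_on UNIV f" unfolding f_def
    by (intro continuous_intros continuous_on_max g(1))
  have fK: "f x = h x" if "x \<in> K" for x using that g(2) by (simp add: f_def)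
  obtain B where B: "B > 0" "\<And>x. x \<in> K \<Longrightarrow> norm x \<le> B"
    using compact_imp_bounded[OF K(1)] unfolding bounded_pos by blast
  have out: "f x = 0" if "norm x \<ge> B + 1" for x
  proof -
    have "1 \<le> infdist x K"
      unfolding infdist_notempty[OF False]
    proof (rule cINF_greatest[OF False])
      show "1 \<le> dist x y" if "y \<in> K" for y
        using B(2)[OF that] \<open>norm x \<ge> B + 1\<close> norm_triangle_ineq2[of x y] by (simp add: dist_norm)
    qed
    then show ?thesis by (simp add: f_def)
  qed
  have "K \<subseteq> ball 0 (B + 1)" using B(2) by force
  have hol: "f holomorphic_on interior K"
    by (rule holomorphic_transform[OF h(2)]) (metis fK interior_subset subsetD)
  define C where "C = 12 + 10^9 * (2 * suminf index_weight)^2"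
  have "C > 0" unfolding C_def by (intro add_pos_nonneg) auto
  show ?thesis
  proof (rule poly_approx_limit)
    fix e :: real assume "e > 0"
    then have "e / C > 0" using \<open>C > 0\<close> by simp
    then obtain F where F: "poly_approx K F"
      "\<And>z. z \<in> K \<Longrightarrow> norm (2 * pi * \<i> * f z - F z) \<le> C * (e / C)"
      using Mergelyan_estimate[OF K f hol out \<open>K \<subseteq> ball 0 (B + 1)\<close>, of "e / C"] unfolding C_def by blast
    have "norm (h z - (1 / (2 * pi * \<i>)) * F z) < e" if z: "z \<in> K" for z
    proof -
      have "h z - (1 / (2 * pi * \<i>)) * F z = (2 * pi * \<i> * f z - F z) / (2 * pi * \<i>)"
        using fK[OF z] by (simp add: field_simps)
      then have "norm (h z - (1 / (2 * pi * \<i>)) * F z) = norm (2 * pi * \<i> * f z - F z) / (2 * pi)"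
        by (simp add: norm_divide norm_mult)
      also have "\<dots> \<le> e / (2 * pi)" using F(2)[OF z] \<open>C > 0\<close> by (intro divide_right_mono) auto
      also have "\<dots> < e / 1" using pi_gt3 \<open>e > 0\<close> by (intro divide_strict_left_mono) auto
      finally show ?thesis by simp
    qed
    then show "\<exists>F. poly_approx K F \<and> (\<forall>z\<in>K. norm (h z - F z) < e)"
      using poly_approx_cmult[OF K(1) F(1)] by blast
  qed
qed

section \<open>Countable families of compact sets and of polynomials\<close>

text \<open>
  The members are complements of connected components of complements of finite unions of closures of basic open sets; there are
  countably many of these. Given \<open>K\<close>, let \<open>F\<close> consist of a path in the complement from \<open>w\<close> to a distant point together with
  the outside of a large disc. Covering \<open>K\<close> by basic sets whose closures miss \<open>F\<close> ensures that the component
  of \<open>w\<close> contains \<open>F\<close>, hence has bounded complement.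
\<close>
lemma countable_exhaustion_connected_complement:
  fixes w :: complex
  obtains \<L> where "countable \<L>" "\<And>L. L \<in> \<L> \<Longrightarrow> compact L \<and> connected (- L) \<and> w \<notin> L"
    "\<And>K. compact K \<Longrightarrow> connected (- K) \<Longrightarrow> w \<notin> K \<Longrightarrow> \<exists>L\<in>\<L>. K \<subseteq> L"
proof -
  obtain \<B> :: "complex set set" where \<B>: "countable \<B>" "topological_basis \<B>"
    using ex_countable_basis by blast
  define fill where "fill Q = - connected_component_set (- (\<Union>b\<in>Q. closure b)) w" for Q :: "complex set set"
  define \<L> where "\<L> = {L \<in> fill ` {Q. finite Q \<and> Q \<subseteq> \<B>}. compact L \<and> connected (- L) \<and> w \<notin> L}"
  show thesis
  proof (rule that[of \<L>])
    show "countable \<L>"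
    proof (rule countable_subset)
      show "\<L> \<subseteq> fill ` {Q. finite Q \<and> Q \<subseteq> \<B>}" by (auto simp: \<L>_def)
      show "countable (fill ` {Q. finite Q \<and> Q \<subseteq> \<B>})"
        by (intro countable_image countable_Collect_finite_subset \<B>)
    qed
    show "compact L \<and> connected (- L) \<and> w \<notin> L" if "L \<in> \<L>" for L
      using that by (simp add: \<L>_def)
    fix K assume K: "compact K" "connected (- K)" "w \<notin> K"
    obtain R where R: "R > 0" "K \<subseteq> ball 0 R"
      using bounded_subset_ballD[OF compact_imp_bounded[OF K(1)], of 0] by blast
    have "of_real R \<in> - K" using R by auto
    moreover have "path_connected (- K)"
      using K compact_imp_closed connected_open_path_connected by blast
    ultimately obtain g where g: "path g" "path_image g \<subseteq> - K" "pathstart g = w" "pathfinish g = of_real R"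
      using K(3) unfolding path_connected_def by (meson ComplI)
    define F where "F = path_image g \<union> - ball 0 R"
    have "of_real R \<in> path_image g" using g(4) pathfinish_in_path_image by metis
    then have Rp: "of_real R \<in> path_image g \<inter> - ball 0 R" using R by simp
    have "connected F" unfolding F_def
    proof (rule connected_Un)
      show "connected (- ball (0::complex) R)"
        by (rule connected_complement_bounded_convex) auto
    qed (use g Rp in \<open>auto intro: connected_path_image\<close>)
    have F: "closed F" "w \<in> F" "K \<inter> F = {}"
      using g R closed_path_image[of g] pathstart_in_path_image[of g] by (auto simp: F_def)
    have cover: "\<exists>b\<in>\<B>. x \<in> b \<and> closure b \<inter> F = {}" if "x \<in> K" for x
    proof -
      have "x \<in> - F" using that F by auto
      then obtain e where e: "e > 0" "cball x e \<subseteq> - F"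
        using F(1) open_contains_cball[of "- F"] by auto
      then obtain b where b: "b \<in> \<B>" "x \<in> b" "b \<subseteq> ball x e"
        using topological_basisE[OF \<B>(2), of "ball x e" x] by auto
      have "closure b \<subseteq> cball x e"
        using b(3) by (metis closure_minimal closed_cball ball_subset_cball order_trans)
      then show ?thesis using b e by blast
    qed
    define \<Q> where "\<Q> = {b \<in> \<B>. closure b \<inter> F = {}}"
    have "K \<subseteq> \<Union>\<Q>" using cover by (auto simp: \<Q>_def)
    moreover have "\<forall>b\<in>\<Q>. open b" using topological_basis_open[OF \<B>(2)] by (auto simp: \<Q>_def)
    ultimately obtain Q where Q: "Q \<subseteq> \<Q>" "finite Q" "K \<subseteq> \<Union>Q"
      using compactE[OF K(1)] by metis
    define V where "V = connected_component_set (- (\<Union>b\<in>Q. closure b)) w"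
    have "(\<Union>b\<in>Q. closure b) \<inter> F = {}"
      using Q(1) by (auto simp: \<Q>_def)
    then have FV: "F \<subseteq> V" unfolding V_def
      using F(2) \<open>connected F\<close> by (intro connected_component_maximal) auto
    have "open V" unfolding V_def using Q(2) by (intro open_connected_component open_Compl closed_UN) auto
    have "- V \<subseteq> ball 0 R" using FV by (auto simp: F_def)
    then have "compact (- V)"
      using \<open>open V\<close> bounded_subset[OF bounded_ball] by (auto simp: compact_eq_bounded_closed)
    moreover have "connected (- (- V))" by (simp add: V_def connected_connected_component)
    moreover have "w \<notin> - V" using FV F by auto
    moreover have "K \<subseteq> - V"
    proof -
      have "V \<subseteq> - (\<Union>b\<in>Q. closure b)" unfolding V_def by (rule connected_component_subset)
      then show ?thesis using Q(3) closure_subset by blast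
    qed
    moreover have "- V \<in> fill ` {Q. finite Q \<and> Q \<subseteq> \<B>}"
      using Q by (auto simp: fill_def V_def \<Q>_def)
    ultimately show "\<exists>L\<in>\<L>. K \<subseteq> L" unfolding \<L>_def by blast
  qed
qed

lemma countable_dense_polys:
  obtains \<P> :: "complex poly set" where "countable \<P>" "\<P> \<noteq> {}"
    "\<And>K p e. compact K \<Longrightarrow> e > 0 \<Longrightarrow> \<exists>q\<in>\<P>. \<forall>z\<in>K. norm (poly p z - poly q z) < e"
proof -
  obtain D :: "complex set" where D: "countable D" "\<And>X. open X \<Longrightarrow> X \<noteq> {} \<Longrightarrow> \<exists>d\<in>D. d \<in> X"
    using countable_dense_exists by blast
  show thesis
  proof (rule that[of "Poly ` lists D"])
    show "countable (Poly ` lists D)" using D(1) by (intro countable_image countable_lists)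
    show "Poly ` lists D \<noteq> {}" by auto
    fix K :: "complex set" and p :: "complex poly" and e :: real
    assume K: "compact K" and "e > 0"
    obtain R where R: "R > 0" "\<And>z. z \<in> K \<Longrightarrow> norm z \<le> R"
      using compact_imp_bounded[OF K] unfolding bounded_pos by blast
    show "\<exists>q\<in>Poly ` lists D. \<forall>z\<in>K. norm (poly p z - poly q z) < e"
      using \<open>e > 0\<close>
    proof (induction p arbitrary: e)
      case 0
      then show ?case by (intro bexI[of _ "Poly []"] imageI) auto
    next
      case (pCons a p)
      obtain xs where xs: "xs \<in> lists D" "\<And>z. z \<in> K \<Longrightarrow> norm (poly p z - poly (Poly xs) z) < e / (2 * R)"
        using pCons.IH[of "e / (2 * R)"] R pCons.prems by auto
      obtain d where d: "d \<in> D" "norm (a - d) < e / 2"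
        using D(2)[of "ball a (e/2)"] pCons.prems by (auto simp: dist_norm)
      have "norm (poly (pCons a p) z - poly (Poly (d # xs)) z) < e" if z: "z \<in> K" for z
      proof -
        have "poly (pCons a p) z - poly (Poly (d # xs)) z = (a - d) + z * (poly p z - poly (Poly xs) z)"
          by (simp add: algebra_simps)
        also have "norm \<dots> \<le> norm (a - d) + norm z * norm (poly p z - poly (Poly xs) z)"
          by (metis norm_mult norm_triangle_ineq)
        also have "\<dots> \<le> norm (a - d) + R * norm (poly p z - poly (Poly xs) z)"
          using R(2)[OF z] by (intro add_left_mono mult_right_mono) auto
        also have "\<dots> < e / 2 + R * (e / (2 * R))"
          using xs(2)[OF z] d R by (intro add_strict_mono mult_strict_left_mono) auto
        also have "\<dots> = e" using R by simp
        finally show ?thesis .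
      qed
      then show ?case using xs d by (intro bexI[of _ "Poly (d # xs)"] imageI) auto
    qed
  qed
qed

section \<open>Universal sequences\<close>

lemma continuous_coefficient:
  assumes "continuous_map (complex_product {..n}) euclidean (f :: (nat \<Rightarrow> complex) \<Rightarrow> complex)"
  shows "continuous_on UNIV (\<lambda>a. f (restrict a {..n}))"
proof -
  have "continuous_map (complex_product UNIV) (complex_product {..n}) (\<lambda>a. restrict a {..n})"
    by (auto simp: continuous_map_componentwise intro: continuous_map_product_projection)
  from continuous_map_compose[OF this assms] show ?thesis
    by (simp add: o_def euclidean_product_topology)
qed

lemma open_polynomial_near:
  fixes c :: "nat \<Rightarrow> 'a::topological_space \<Rightarrow> complex"
  assumes c: "\<And>n. continuous_on UNIV (c n)" and L: "compact L" and g: "continuous_on L g"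
  shows "open {a. \<forall>z\<in>L. norm ((\<Sum>n=0..N. c n a * z ^ n) - g z) < e}"
proof (cases "L = {}")
  case False
  obtain R where R: "R > 0" "\<And>z. z \<in> L \<Longrightarrow> norm z \<le> R"
    using compact_imp_bounded[OF L] unfolding bounded_pos by blast
  define s where "s = (\<Sum>n=0..N. R ^ n)"
  have "s > 0" unfolding s_def using R by (intro sum_pos) auto
  let ?A = "{a. \<forall>z\<in>L. norm ((\<Sum>n=0..N. c n a * z ^ n) - g z) < e}"
  show ?thesis
  proof (subst open_subopen, intro ballI)
    fix a0 assume a0: "a0 \<in> ?A"
    have "continuous_on L (\<lambda>z. norm ((\<Sum>n=0..N. c n a0 * z ^ n) - g z))"
      by (intro continuous_intros g)
    from continuous_attains_sup[OF L False this] obtain z0 where z0: "z0 \<in> L"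
      "\<And>z. z \<in> L \<Longrightarrow> norm ((\<Sum>n=0..N. c n a0 * z ^ n) - g z) \<le> norm ((\<Sum>n=0..N. c n a0 * z0 ^ n) - g z0)"
      by blast
    define m where "m = norm ((\<Sum>n=0..N. c n a0 * z0 ^ n) - g z0)"
    have "m < e" using a0 z0(1) by (simp add: m_def)
    define \<eta> where "\<eta> = (e - m) / (2 * s)"
    have "\<eta> > 0" using \<open>m < e\<close> \<open>s > 0\<close> by (simp add: \<eta>_def)
    define W where "W = (\<Inter>n\<in>{0..N}. {a. norm (c n a - c n a0) < \<eta>})"
    have "open W" unfolding W_def
      by (intro open_INT ballI open_Collect_less continuous_intros c) auto
    moreover have "a0 \<in> W" using \<open>\<eta> > 0\<close> by (simp add: W_def)
    moreover have "W \<subseteq> ?A"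
    proof (intro subsetI CollectI ballI)
      fix a z assume a: "a \<in> W" and z: "z \<in> L"
      have "norm ((\<Sum>n=0..N. c n a * z ^ n) - (\<Sum>n=0..N. c n a0 * z ^ n)) = norm (\<Sum>n=0..N. (c n a - c n a0) * z ^ n)"
        by (simp add: sum_subtractf left_diff_distrib)
      also have "\<dots> \<le> (\<Sum>n=0..N. \<eta> * R ^ n)"
      proof (rule sum_norm_le)
        fix n assume "n \<in> {0..N}"
        then have "norm (c n a - c n a0) \<le> \<eta>" using a by (auto simp: W_def less_imp_le)
        then show "norm ((c n a - c n a0) * z ^ n) \<le> \<eta> * R ^ n"
          unfolding norm_mult norm_power using R z \<open>\<eta> > 0\<close> by (intro mult_mono power_mono) auto
      qed
      also have "\<dots> = \<eta> * s" by (simp only: sum_distrib_left s_def)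
      also have "\<dots> = (e - m) / 2" using \<open>s > 0\<close> by (simp add: \<eta>_def)
      finally have "norm ((\<Sum>n=0..N. c n a * z ^ n) - (\<Sum>n=0..N. c n a0 * z ^ n)) \<le> (e - m) / 2" .
      moreover have "norm ((\<Sum>n=0..N. c n a0 * z ^ n) - g z) \<le> m" using z0(2)[OF z] by (simp add: m_def)
      ultimately have "norm (((\<Sum>n=0..N. c n a * z ^ n) - (\<Sum>n=0..N. c n a0 * z ^ n)) + ((\<Sum>n=0..N. c n a0 * z ^ n) - g z)) \<le> (e - m) / 2 + m"
        by (intro order_trans[OF norm_triangle_ineq] add_mono)
      then have "norm ((\<Sum>n=0..N. c n a * z ^ n) - g z) \<le> (e - m) / 2 + m" by simp
      also have "\<dots> < e" using \<open>m < e\<close> by (simp add: field_simps)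
      finally show "norm ((\<Sum>n=0..N. c n a * z ^ n) - g z) < e" .
    qed
    ultimately show "\<exists>T. open T \<and> a0 \<in> T \<and> T \<subseteq> ?A" by blast
  qed
qed auto

lemma open_product_contains_cylinder:
  fixes G :: "(nat \<Rightarrow> 'a::topological_space) set"
  assumes "open G" "a0 \<in> G"
  obtains N where "\<And>a. (\<And>i. i \<le> N \<Longrightarrow> a i = a0 i) \<Longrightarrow> a \<in> G"
proof -
  have "openin (product_topology (\<lambda>_. euclidean) UNIV) G"
    using assms(1) by (simp add: euclidean_product_topology)
  from product_topology_open_contains_basis[OF this assms(2)] obtain X where
    X: "a0 \<in> (\<Pi>\<^sub>E i\<in>UNIV. X i)" "finite {i. X i \<noteq> UNIV}" "(\<Pi>\<^sub>E i\<in>UNIV. X i) \<subseteq> G"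
    by auto
  obtain N where N: "\<forall>i\<in>{i. X i \<noteq> UNIV}. i \<le> N"
    using X(2) finite_nat_set_iff_bounded_le by blast
  show thesis
  proof (rule that[of N])
    fix a assume a: "\<And>i. i \<le> N \<Longrightarrow> a i = a0 i"
    have "a i \<in> X i" for i
    proof (cases "X i = UNIV")
      case False
      then show ?thesis using N a X(1) by (auto simp: PiE_iff)
    qed auto
    then show "a \<in> G" using X(3) by (auto simp: PiE_iff)
  qed
qed

text \<open>
  The coordinates after \<open>N\<close> are chosen recursively: surjectivity in the last variable solves the equation for each
  coefficient once the earlier coordinates are fixed.
\<close>
lemma exists_prescribed_coefficients:
  fixes b :: "nat \<Rightarrow> (nat \<Rightarrow> complex) \<Rightarrow> complex"
  assumes surj: "\<And>n a. a \<in> topspace (complex_product {..<n}) \<Longrightarrow> surj (\<lambda>z. b n (a(n := z)))"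
  obtains a where "\<And>n. n \<le> N \<Longrightarrow> a n = a0 n" "\<And>n. n > N \<Longrightarrow> b n (restrict a {..n}) = t n"
proof -
  define P where "P a n r \<longleftrightarrow> (if n \<le> N then r = a0 n else b n ((restrict a {..<n})(n := r)) = t n)" for a n r
  have "\<exists>a. \<forall>n. P a n (a n)"
  proof (rule dependent_wf_choice[OF wf_less_than])
    fix a a' :: "nat \<Rightarrow> complex" and n r assume "\<And>m. (m, n) \<in> less_than \<Longrightarrow> a m = a' m"
    then have "restrict a {..<n} = restrict a' {..<n}" by (auto simp: restrict_def)
    then show "P a n r = P a' n r" by (simp add: P_def)
  next
    fix n and a :: "nat \<Rightarrow> complex"
    have "surj (\<lambda>z. b n ((restrict a {..<n})(n := z)))" by (rule surj) simp
    then obtain r where "t n = b n ((restrict a {..<n})(n := r))" by (auto simp: surj_def)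
    then show "\<exists>r. P a n r" by (auto simp: P_def)
  qed
  then obtain a where a: "\<And>n. P a n (a n)" by blast
  have r: "(restrict a {..<n})(n := a n) = restrict a {..n}" for n
    by (auto simp: restrict_def)
  show thesis
  proof (rule that[of a])
    show "a n = a0 n" if "n \<le> N" for n using a[of n] that by (simp add: P_def)
    show "b n (restrict a {..n}) = t n" if "n > N" for n
      using a[of n] that r[of n] by (simp add: P_def)
  qed
qed

lemma poly_eq_sum_up_to:
  fixes q :: "complex poly"
  assumes "degree q \<le> m"
  shows "poly q z = (\<Sum>k\<le>m. coeff q k * z ^ k)"
  unfolding poly_altdef using assms
  by (intro sum.mono_neutral_left) (auto simp: coeff_eq_0)

text \<open>
  An open set leaves the coordinates after some \<open>N\<close> free. Dividing by \<open>z ^ (N+1)\<close> is possible within the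
  uniform limits of polynomials on \<open>L\<close> because 0 lies in the connected complement of \<open>L\<close>; this turns the approximation of
  \<open>p\<close> into one that involves only the free coefficients. The index \<open>l\<close> may be taken arbitrarily large, since the coefficients
  beyond the degree of \<open>q\<close> are prescribed to be 0.
\<close>
lemma T_approximates_densely:
  assumes surj: "\<And>n a. a \<in> topspace (complex_product {..<n}) \<Longrightarrow> surj (\<lambda>z. b n (a(n := z)))"
    and "infinite \<mu>" and L: "compact L" "connected (- L)" "0 \<notin> L"
    and "open G" "G \<noteq> {}" "e > 0"
  obtains a l where "a \<in> G" "l \<in> \<mu>" "l \<ge> M" "\<And>z. z \<in> L \<Longrightarrow> norm (T b l a z - poly p z) < e"
proof -
  obtain a0 where "a0 \<in> G" using assms by blast
  obtain N where N: "\<And>a. (\<And>i. i \<le> N \<Longrightarrow> a i = a0 i) \<Longrightarrow> a \<in> G"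
    using open_product_contains_cylinder[OF \<open>open G\<close> \<open>a0 \<in> G\<close>] by blast
  obtain R where R: "R > 0" "\<And>z. z \<in> L \<Longrightarrow> norm z \<le> R"
    using compact_imp_bounded[OF L(1)] unfolding bounded_pos by blast
  define S where "S z = (\<Sum>n=0..N. b n (restrict a0 {..n}) * z ^ n)" for z
  have "poly_approx L (\<lambda>z. (poly p z - S z) * (1 / (z - 0)) ^ Suc N)"
    unfolding S_def
    by (intro poly_approx_mult poly_approx_diff poly_approx_power poly_approx_pole poly_approx_poly
        poly_approx_sum poly_approx_cmult poly_approx_ident L)
  then obtain q where q: "\<And>z. z \<in> L \<Longrightarrow> norm ((poly p z - S z) * (1 / (z - 0)) ^ Suc N - poly q z) < e / R ^ Suc N"
    unfolding poly_approx_def using \<open>e > 0\<close> R by (meson divide_pos_pos zero_less_power)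
  obtain l where l: "l \<in> \<mu>" "l > max M (Suc N + degree q)"
    using \<open>infinite \<mu>\<close> unfolding infinite_nat_iff_unbounded by blast
  obtain a where a: "\<And>n. n \<le> N \<Longrightarrow> a n = a0 n" "\<And>n. n > N \<Longrightarrow> b n (restrict a {..n}) = coeff q (n - Suc N)"
    using exists_prescribed_coefficients[OF surj, of N a0 "\<lambda>n. coeff q (n - Suc N)"] by blast
  have T: "T b l a z = S z + z ^ Suc N * poly q z" for z
  proof -
    have "T b l a z = (\<Sum>n=0..N. b n (restrict a {..n}) * z ^ n) + (\<Sum>n=Suc N..l. b n (restrict a {..n}) * z ^ n)"
      unfolding T_def using l sum.ub_add_nat[of 0 N "\<lambda>n. b n (restrict a {..n}) * z ^ n" "l - N"] by simp
    also have "(\<Sum>n=0..N. b n (restrict a {..n}) * z ^ n) = S z"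
    proof -
      have "restrict a {..n} = restrict a0 {..n}" if "n \<le> N" for n
        using a(1) that by (auto simp: restrict_def)
      then show ?thesis unfolding S_def by (intro sum.cong) auto
    qed
    also have "(\<Sum>n=Suc N..l. b n (restrict a {..n}) * z ^ n) = (\<Sum>k\<le>l - Suc N. coeff q k * z ^ (k + Suc N))"
      by (rule sum.reindex_bij_witness[of _ "\<lambda>k. k + Suc N" "\<lambda>n. n - Suc N"]) (use a(2) l in auto)
    also have "\<dots> = z ^ Suc N * (\<Sum>k\<le>l - Suc N. coeff q k * z ^ k)"
      by (simp add: sum_distrib_left power_add mult_ac)
    also have "(\<Sum>k\<le>l - Suc N. coeff q k * z ^ k) = poly q z"
      using l by (intro poly_eq_sum_up_to[symmetric]) auto
    finally show ?thesis .
  qed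
  show thesis
  proof (rule that[of a l])
    show "a \<in> G" using N a(1) by blast
    show "norm (T b l a z - poly p z) < e" if z: "z \<in> L" for z
    proof -
      have "z \<noteq> 0" using z L by auto
      then have "z ^ Suc N * (1 / (z - 0)) ^ Suc N = 1" by (simp only: power_mult_distrib[symmetric]) simp
      then have "z ^ Suc N * ((poly p z - S z) * (1 / (z - 0)) ^ Suc N) = poly p z - S z"
        by (metis mult.left_commute mult.right_neutral)
      then have "T b l a z - poly p z = - (z ^ Suc N * ((poly p z - S z) * (1 / (z - 0)) ^ Suc N - poly q z))"
        unfolding T right_diff_distrib by simp
      then have "norm (T b l a z - poly p z) = norm z ^ Suc N * norm ((poly p z - S z) * (1 / (z - 0)) ^ Suc N - poly q z)"
        by (simp only: norm_minus_cancel norm_mult norm_power)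
      also have "\<dots> \<le> R ^ Suc N * norm ((poly p z - S z) * (1 / (z - 0)) ^ Suc N - poly q z)"
        using R z by (intro mult_right_mono power_mono) auto
      also have "\<dots> < R ^ Suc N * (e / R ^ Suc N)"
        using q[OF z] R(1) by (intro mult_strict_left_mono zero_less_power)
      also have "\<dots> = e" using R by simp
      finally show ?thesis .
    qed
  qed (use l in auto)
qed

text \<open>
  The bound \<open>M\<close> encodes that indices from \<open>\<mu>\<close> can be picked in increasing order. From right to left, Mergelyan's theorem replaces \<open>h\<close>
  by a polynomial on \<open>K\<close> itself; only then is \<open>K\<close> enlarged to a member of the countable family.
\<close>
lemma U_iff_polynomials:
  assumes \<L>: "\<And>L. L \<in> \<L> \<Longrightarrow> compact L \<and> connected (- L) \<and> 0 \<notin> L"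
    "\<And>K. compact K \<Longrightarrow> connected (- K) \<Longrightarrow> 0 \<notin> K \<Longrightarrow> \<exists>L\<in>\<L>. K \<subseteq> L"
   and \<P>: "\<And>K p e. compact K \<Longrightarrow> e > 0 \<Longrightarrow> \<exists>q\<in>\<P>. \<forall>z\<in>K. norm (poly p z - poly q z) < e"
  shows "a \<in> U b \<mu> \<longleftrightarrow>
     (\<forall>L\<in>\<L>. \<forall>p\<in>\<P>. \<forall>k M. \<exists>l\<in>\<mu>. M \<le> l \<and> (\<forall>z\<in>L. norm (T b l a z - poly p z) < 1 / real (Suc k)))"
    (is "_ \<longleftrightarrow> ?R")
proof
  assume a: "a \<in> U b \<mu>"
  show ?R
  proof (intro ballI allI)
    fix L p k M assume "L \<in> \<L>"
    then have "compact L \<and> L \<subseteq> UNIV - {0} \<and> connected (UNIV - L) \<and> continuous_on L (poly p) \<and> poly p holomorphic_on interior L"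
      using \<L>(1)[of L] by (auto simp: Compl_eq_Diff_UNIV[symmetric] intro!: continuous_intros holomorphic_intros)
    then obtain l :: "nat \<Rightarrow> nat" where l: "strict_mono l" "\<And>m. l m \<in> \<mu>" "uniform_limit L (\<lambda>m. T b (l m) a) (poly p) sequentially"
      using a unfolding U_def by blast
    have "\<forall>\<^sub>F m in sequentially. \<forall>z\<in>L. dist (T b (l m) a z) (poly p z) < 1 / real (Suc k)"
      using l(3) unfolding uniform_limit_iff by simp
    then obtain m0 where "\<And>m z. m \<ge> m0 \<Longrightarrow> z \<in> L \<Longrightarrow> dist (T b (l m) a z) (poly p z) < 1 / real (Suc k)"
      unfolding eventually_sequentially by blast
    then have "\<forall>z\<in>L. norm (T b (l (max m0 M)) a z - poly p z) < 1 / real (Suc k)"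
      by (simp add: dist_norm)
    moreover have "M \<le> l (max m0 M)" using seq_suble[OF l(1), of "max m0 M"] by simp
    ultimately show "\<exists>l\<in>\<mu>. M \<le> l \<and> (\<forall>z\<in>L. norm (T b l a z - poly p z) < 1 / real (Suc k))"
      using l(2) by blast
  qed
next
  assume R: ?R
  show "a \<in> U b \<mu>"
    unfolding U_def
  proof (intro CollectI allI impI)
    fix K h assume "compact K \<and> K \<subseteq> UNIV - {0} \<and> connected (UNIV - K) \<and> continuous_on K h \<and> h holomorphic_on interior K"
    then have K: "compact K" "0 \<notin> K" "connected (- K)" "continuous_on K h" "h holomorphic_on interior K"
      by (auto simp: Compl_eq_Diff_UNIV)
    obtain L where L: "L \<in> \<L>" "K \<subseteq> L" using \<L>(2) K by blast
    have near: "\<exists>l\<in>\<mu>. M \<le> l \<and> (\<forall>z\<in>K. norm (T b l a z - h z) < e)" if "e > 0" for e :: real and M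
    proof -
      obtain p0 where p0: "\<forall>z\<in>K. norm (h z - poly p0 z) < e / 3"
        using Mergelyan[OF K(1,3,4,5)] \<open>e > 0\<close> unfolding poly_approx_def by (meson divide_pos_pos zero_less_numeral)
      obtain p where p: "p \<in> \<P>" "\<forall>z\<in>K. norm (poly p0 z - poly p z) < e / 3"
        using \<P>[OF K(1), of "e/3" p0] \<open>e > 0\<close> by auto
      obtain k where k: "1 / real (Suc k) < e / 3"
        using nat_approx_posE[of "e/3"] \<open>e > 0\<close> by auto
      obtain l where l: "l \<in> \<mu>" "M \<le> l" "\<forall>z\<in>L. norm (T b l a z - poly p z) < 1 / real (Suc k)"
        using R L(1) p(1) by blast
      have "norm (T b l a z - h z) < e" if z: "z \<in> K" for z
      proof -
        have "norm (T b l a z - poly p z) < e / 3" using l(3) z L k by fastforce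
        moreover have "norm (poly p0 z - poly p z) < e / 3" "norm (h z - poly p0 z) < e / 3" using p p0 z by auto
        moreover have "dist (T b l a z) (h z) \<le> dist (T b l a z) (poly p z) + (dist (poly p0 z) (poly p z) + dist (h z) (poly p0 z))"
          using dist_triangle[of "T b l a z" "h z" "poly p z"] dist_triangle3[of "poly p z" "h z" "poly p0 z"]
          by (simp add: dist_commute)
        ultimately show ?thesis by (simp add: dist_norm)
      qed
      then show ?thesis using l by blast
    qed
    have "\<exists>l :: nat \<Rightarrow> nat. \<forall>m. (l m \<in> \<mu> \<and> (\<forall>z\<in>K. norm (T b (l m) a z - h z) < 1 / real (Suc m))) \<and> l m < l (Suc m)"
    proof (rule dependent_nat_choice)
      show "\<exists>x. x \<in> \<mu> \<and> (\<forall>z\<in>K. norm (T b x a z - h z) < 1 / real (Suc 0))"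
        using near[of 1 0] by auto
      show "\<exists>y. (y \<in> \<mu> \<and> (\<forall>z\<in>K. norm (T b y a z - h z) < 1 / real (Suc (Suc n)))) \<and> x < y" for x n
        using near[of "1 / real (Suc (Suc n))" "Suc x"] by (auto simp: Suc_le_eq)
    qed
    then obtain l :: "nat \<Rightarrow> nat" where l: "\<And>m. l m \<in> \<mu>" "\<And>m z. z \<in> K \<Longrightarrow> norm (T b (l m) a z - h z) < 1 / real (Suc m)"
      "\<And>m. l m < l (Suc m)"
      by metis
    have "uniform_limit K (\<lambda>m. T b (l m) a) h sequentially"
      unfolding uniform_limit_iff
    proof (intro allI impI)
      fix e :: real assume "e > 0"
      then obtain k where k: "1 / real (Suc k) < e" using nat_approx_posE by blast
      have "dist (T b (l m) a z) (h z) < e" if "m \<ge> k" "z \<in> K" for m z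
      proof -
        have "1 / real (Suc m) \<le> 1 / real (Suc k)" using that by (intro divide_left_mono) auto
        then show ?thesis using l(2)[OF that(2), of m] k by (simp add: dist_norm)
      qed
      then show "\<forall>\<^sub>F m in sequentially. \<forall>z\<in>K. dist (T b (l m) a z) (h z) < e"
        unfolding eventually_sequentially by blast
    qed
    then show "\<exists>l :: nat \<Rightarrow> nat. strict_mono l \<and> (\<forall>m. l m \<in> \<mu>) \<and> uniform_limit K (\<lambda>m. T b (l m) a) h sequentially"
      using l by (intro exI[of _ l]) (auto simp: strict_mono_Suc_iff)
  qed
qed

theorem theorem6:
  fixes b :: "nat \<Rightarrow> (nat \<Rightarrow> complex) \<Rightarrow> complex" and \<mu> :: "nat set"
  assumes "\<And>n. continuous_map (complex_product {..n}) euclidean (b n)"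
    and "\<And>n a. a \<in> topspace (complex_product {..<n}) \<Longrightarrow> surj (\<lambda>z. b n (a(n := z)))"
    and "infinite \<mu>"
  shows "gdelta_in (complex_product UNIV) (U b \<mu>) \<and>
         (complex_product UNIV) closure_of (U b \<mu>) = topspace (complex_product UNIV)"
proof -
  obtain \<L> where \<L>: "countable \<L>" "\<And>L. L \<in> \<L> \<Longrightarrow> compact L \<and> connected (- L) \<and> (0::complex) \<notin> L"
    "\<And>K. compact K \<Longrightarrow> connected (- K) \<Longrightarrow> (0::complex) \<notin> K \<Longrightarrow> \<exists>L\<in>\<L>. K \<subseteq> L"
    using countable_exhaustion_connected_complement[of 0] by blast
  obtain \<P> :: "complex poly set" where \<P>: "countable \<P>" "\<P> \<noteq> {}"
    "\<And>K p e. compact K \<Longrightarrow> e > 0 \<Longrightarrow> \<exists>q\<in>\<P>. \<forall>z\<in>K. norm (poly p z - poly q z) < e"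
    using countable_dense_polys by blast
  have "\<L> \<noteq> {}" using \<L>(3)[of "{}"] by auto
  define E where "E = (\<lambda>(L, p, k, M). \<Union>l\<in>{l\<in>\<mu>. M \<le> l}. {a. \<forall>z\<in>L. norm (T b l a z - poly p z) < 1 / real (Suc k)})"
  define \<G> where "\<G> = E ` (\<L> \<times> \<P> \<times> (UNIV :: nat set) \<times> (UNIV :: nat set))"
  have U: "U b \<mu> = \<Inter>\<G>"
    using U_iff_polynomials[OF \<L>(2,3) \<P>(3), where b = b and \<mu> = \<mu>] by (fastforce simp: \<G>_def E_def)
  have \<G>: "countable \<G>" "\<G> \<noteq> {}"
    using \<L>(1) \<P>(1,2) \<open>\<L> \<noteq> {}\<close> by (auto simp: \<G>_def)
  have open_G: "openin (complex_product UNIV) G" if "G \<in> \<G>" for G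
  proof -
    obtain L p k M where L: "L \<in> \<L>" and G: "G = E (L, p, k, M)" using \<open>G \<in> \<G>\<close> by (auto simp: \<G>_def)
    have "open {a. \<forall>z\<in>L. norm (T b l a z - poly p z) < 1 / real (Suc k)}" for l
      unfolding T_def using \<L>(2)[OF L]
      by (intro open_polynomial_near continuous_coefficient assms(1) continuous_intros) auto
    then show ?thesis unfolding G E_def by (auto simp: euclidean_product_topology)
  qed
  have dense: "(complex_product UNIV) closure_of G = topspace (complex_product UNIV)" if "G \<in> \<G>" for G
  proof -
    obtain L p k M where L: "L \<in> \<L>" and G: "G = E (L, p, k, M)" using \<open>G \<in> \<G>\<close> by (auto simp: \<G>_def)
    have "G \<inter> W \<noteq> {}" if W: "open W" "W \<noteq> {}" for W
    proof -
      obtain a l where "a \<in> W" "l \<in> \<mu>" "l \<ge> M" "\<And>z. z \<in> L \<Longrightarrow> norm (T b l a z - poly p z) < 1 / real (Suc k)"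
        using T_approximates_densely[OF assms(2,3) _ _ _ W, of L "1 / real (Suc k)" M p] \<L>(2)[OF L] by auto
      then show ?thesis unfolding G E_def by blast
    qed
    then show ?thesis
      unfolding dense_intersects_open by (auto simp: euclidean_product_topology)
  qed
  have "completely_metrizable_space (complex_product UNIV)"
    by (simp add: completely_metrizable_space_product_topology completely_metrizable_space_euclidean)
  then have "(complex_product UNIV) closure_of (\<Inter>\<G>) = topspace (complex_product UNIV)"
    using \<G>(1) open_G dense by (intro Baire_category) auto
  moreover have "gdelta_in (complex_product UNIV) (\<Inter>\<G>)"
    using \<G> open_G by (intro gdelta_in_Inter open_imp_gdelta_in)
  ultimately show ?thesis unfolding U by simp
qed

end
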